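(* Let $(M,\langle\cdot,\cdot\rangle)$ be a Riemannian manifold, $\mathcal M=\mathrm{Imm}([0,1],M)$ the space of smooth immersions $[0,1]\to M$ equipped with the Riemannian metric $$G_c(h,k)=\langle h(0),k(0)\rangle+\int_0^1\Big(\langle\nabla_\ell h^N,\nabla_\ell k^N\rangle+\tfrac14\langle\nabla_\ell h^T,\nabla_\ell k^T\rangle\Big)\|c'(t)\|\,\mathrm dt,$$ and let $\pi^{( * )}:\mathcal M\to M$, $c\mapsto c(0)$. For $c\in\mathcal M$ set $$V^{( * )}_c\mathcal M=\ker T_c\pi^{( * )}=\{h\in T_c\mathcal M: h(0)=0\},\qquad H^{( * )}_c\mathcal M=\big(V^{( * )}_c\mathcal M\big)^{\perp_G}.$$ Then: (i) for every $c\in\mathcal M$, $T_c\mathcal M=V^{( * )}_c\mathcal M\oplus H^{( * )}_c\mathcal M$ (a $G$-orthogonal direct sum); (ii) for every $c\in\mathcal M$, $H^{( * )}_c\mathcal M$ consists of the parallel vector fields along $c$; (iii) $\pi^{( * )}$ is a Riemannian submersion from $(\mathcal M,G)$ to $(M,\langle\cdot,\cdot\rangle)$, i.e. for every $c\in\mathcal M$ the map $T_c\pi^{( * )}$ restricts to a linear isometry of $(H^{( * )}_c\mathcal M,G_c)$ onto $(T_{c(0)}M,\langle\cdot,\cdot\rangle)$.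
   Context: $(M,\langle\cdot,\cdot\rangle)$ is a (finite-dimensional, smooth) Riemannian manifold with norm $\|\cdot\|$ and Levi-Civita connection $\nabla$. $\mathcal M=\mathrm{Imm}([0,1],M)=\{c\in C^\infty([0,1],M): c'(t)\ne0\ \forall t\in[0,1]\}$. A tangent vector $h\in T_c\mathcal M$ is a smooth vector field along $c$, i.e. a smooth map $h:[0,1]\to TM$ with $h(t)\in T_{c(t)}M$. The derivative of $\pi^{( * )}$ is $T_c\pi^{( * )}(h)=h(0)$. For $c\in\mathcal M$ and $h\in T_c\mathcal M$: $v=c'/\|c'\|$, $\nabla_\ell h=\frac1{\|c'\|}\nabla_{c'}h$ is the covariant derivative of $h$ along $c$ with respect to arc length, $\nabla_\ell h^T=\langle\nabla_\ell h,v\rangle v$ and $\nabla_\ell h^N=\nabla_\ell h-\nabla_\ell h^T$. A vector field $h$ along $c$ is parallel if $\nabla_{c'}h=0$. $\perp_G$ denotes the orthogonal complement in $T_c\mathcal M$ with respect to $G_c$. *)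

theory Defs
  imports "HOL-Analysis.Analysis" "HOL-Library.Function_Algebras"
begin

instantiation "fun" :: (type, real_vector) real_vector
begin

definition scaleR_fun :: "real \<Rightarrow> ('a \<Rightarrow> 'b) \<Rightarrow> 'a \<Rightarrow> 'b"
  where "scaleR_fun a f = (\<lambda>x. a *\<^sub>R f x)"

instance
  by standard (simp_all add: scaleR_fun_def fun_eq_iff scaleR_add_right scaleR_add_left)

end

section \<open>Smooth maps between Euclidean spaces\<close>

text \<open>
  Derivatives are taken within \<open>S\<close>, so the notion is meant for sets in which they are unique:
  open sets, and relatively open subsets of a nondegenerate interval, where derivatives at an
  endpoint are one-sided.
\<close>

primrec Ck_on :: "nat \<Rightarrow> 'a::euclidean_space set \<Rightarrow> ('a \<Rightarrow> 'b::real_normed_vector) \<Rightarrow> bool" where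
  "Ck_on 0 S f \<longleftrightarrow> continuous_on S f"
| "Ck_on (Suc k) S f \<longleftrightarrow> f differentiable_on S \<and>
     (\<forall>v. Ck_on k S (\<lambda>x. frechet_derivative f (at x within S) v))"

definition smooth_on :: "'a::euclidean_space set \<Rightarrow> ('a \<Rightarrow> 'b::real_normed_vector) \<Rightarrow> bool"
  where "smooth_on S f \<longleftrightarrow> (\<forall>k. Ck_on k S f)"

section \<open>Smooth manifolds and tangent spaces\<close>

text \<open>
  A chart is a domain together with a coordinate map into the model space; the values of the
  coordinate map outside the domain are irrelevant.
\<close>

type_synonym ('a, 'e) chart = "'a set \<times> ('a \<Rightarrow> 'e)"

abbreviation chart_dom :: "('a, 'e) chart \<Rightarrow> 'a set"
  where "chart_dom \<equiv> fst"

abbreviation chart_map :: "('a, 'e) chart \<Rightarrow> 'a \<Rightarrow> 'e"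
  where "chart_map \<equiv> snd"

abbreviation chart_range :: "('a, 'e) chart \<Rightarrow> 'e set"
  where "chart_range \<kappa> \<equiv> chart_map \<kappa> ` chart_dom \<kappa>"

definition chart_inv :: "('a, 'e) chart \<Rightarrow> 'e \<Rightarrow> 'a"
  where "chart_inv \<kappa> = inv_into (chart_dom \<kappa>) (chart_map \<kappa>)"

definition chart_trans :: "('a, 'e) chart \<Rightarrow> ('a, 'e) chart \<Rightarrow> 'e \<Rightarrow> 'e"
  where "chart_trans \<kappa> \<mu> = chart_map \<mu> \<circ> chart_inv \<kappa>"

definition smooth_manifold :: "'a topology \<Rightarrow> ('a, 'e::euclidean_space) chart set \<Rightarrow> bool"
  where "smooth_manifold X A \<longleftrightarrow>
    Hausdorff_space X \<and> second_countable X \<and>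
    (\<Union>\<kappa>\<in>A. chart_dom \<kappa>) = topspace X \<and>
    (\<forall>\<kappa>\<in>A. openin X (chart_dom \<kappa>) \<and> open (chart_range \<kappa>) \<and>
       homeomorphic_map (subtopology X (chart_dom \<kappa>)) (top_of_set (chart_range \<kappa>))
         (chart_map \<kappa>)) \<and>
    (\<forall>\<kappa>\<in>A. \<forall>\<mu>\<in>A.
       smooth_on (chart_map \<kappa> ` (chart_dom \<kappa> \<inter> chart_dom \<mu>)) (chart_trans \<kappa> \<mu>))"

text \<open>
  A tangent vector at \<open>p\<close> is the family of its coordinate representations in the charts around
  \<open>p\<close>, any two of which are related by the derivative of the transition map; its value is \<open>0\<close> at
  all other charts, so that equality of tangent vectors is equality of functions.
\<close>

type_synonym ('a, 'e) tvec = "('a, 'e) chart \<Rightarrow> 'e"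

definition charts_at :: "('a, 'e) chart set \<Rightarrow> 'a \<Rightarrow> ('a, 'e) chart set"
  where "charts_at A p = {\<kappa>\<in>A. p \<in> chart_dom \<kappa>}"

definition tangent_space :: "('a, 'e::euclidean_space) chart set \<Rightarrow> 'a \<Rightarrow> ('a, 'e) tvec set"
  where "tangent_space A p = {\<xi>.
    (\<forall>\<kappa>\<in>charts_at A p. \<forall>\<mu>\<in>charts_at A p.
       \<xi> \<mu> = frechet_derivative (chart_trans \<kappa> \<mu>) (at (chart_map \<kappa> p)) (\<xi> \<kappa>)) \<and>
    (\<forall>\<kappa>. \<kappa> \<notin> charts_at A p \<longrightarrow> \<xi> \<kappa> = 0)}"

text \<open>The tangent vector at \<open>p\<close> whose representation in the chart \<open>\<kappa>\<close> is \<open>u\<close>.\<close>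

definition coord_tvec ::
  "('a, 'e::euclidean_space) chart set \<Rightarrow> ('a, 'e) chart \<Rightarrow> 'a \<Rightarrow> 'e \<Rightarrow> ('a, 'e) tvec"
  where "coord_tvec A \<kappa> p u = (\<lambda>\<mu>. if \<mu> \<in> charts_at A p
    then frechet_derivative (chart_trans \<kappa> \<mu>) (at (chart_map \<kappa> p)) u else 0)"

section \<open>Riemannian metrics and the Levi-Civita connection\<close>

definition inner_product_on :: "'v::real_vector set \<Rightarrow> ('v \<Rightarrow> 'v \<Rightarrow> real) \<Rightarrow> bool"
  where "inner_product_on V b \<longleftrightarrow>
    (\<forall>x\<in>V. \<forall>y\<in>V. b x y = b y x) \<and>
    (\<forall>x\<in>V. \<forall>y\<in>V. \<forall>z\<in>V. b (x + y) z = b x z + b y z) \<and>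
    (\<forall>a. \<forall>x\<in>V. \<forall>y\<in>V. b (a *\<^sub>R x) y = a * b x y) \<and>
    (\<forall>x\<in>V. x \<noteq> 0 \<longrightarrow> b x x > 0)"

type_synonym ('a, 'e) metric = "'a \<Rightarrow> ('a, 'e) tvec \<Rightarrow> ('a, 'e) tvec \<Rightarrow> real"

definition local_metric :: "('a, 'e::euclidean_space) chart set \<Rightarrow> ('a, 'e) metric \<Rightarrow>
    ('a, 'e) chart \<Rightarrow> 'e \<Rightarrow> 'e \<Rightarrow> 'e \<Rightarrow> real"
  where "local_metric A g \<kappa> x u v =
    (let p = chart_inv \<kappa> x in g p (coord_tvec A \<kappa> p u) (coord_tvec A \<kappa> p v))"

definition riemannian_manifold ::
  "'a topology \<Rightarrow> ('a, 'e::euclidean_space) chart set \<Rightarrow> ('a, 'e) metric \<Rightarrow> bool"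
  where "riemannian_manifold X A g \<longleftrightarrow>
    smooth_manifold X A \<and>
    (\<forall>p\<in>topspace X. inner_product_on (tangent_space A p) (g p)) \<and>
    (\<forall>\<kappa>\<in>A. \<forall>u v. smooth_on (chart_range \<kappa>) (\<lambda>x. local_metric A g \<kappa> x u v))"

text \<open>
  An affine connection is given by its Christoffel maps: in the chart \<open>\<kappa>\<close>, the covariant
  derivative of the vector field \<open>Y\<close> in direction \<open>u\<close> at \<open>x\<close> is \<open>DY(x) u + \<Gamma> \<kappa> x u (Y x)\<close>.
  The last condition is the change-of-chart rule expressing that this is a tangent vector
  independent of the chart.
\<close>

type_synonym ('a, 'e) christoffel = "('a, 'e) chart \<Rightarrow> 'e \<Rightarrow> 'e \<Rightarrow> 'e \<Rightarrow> 'e"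

definition affine_connection ::
  "('a, 'e::euclidean_space) chart set \<Rightarrow> ('a, 'e) christoffel \<Rightarrow> bool"
  where "affine_connection A \<Gamma> \<longleftrightarrow>
    (\<forall>\<kappa>\<in>A. (\<forall>x\<in>chart_range \<kappa>. bilinear (\<Gamma> \<kappa> x)) \<and>
       (\<forall>u v. smooth_on (chart_range \<kappa>) (\<lambda>x. \<Gamma> \<kappa> x u v))) \<and>
    (\<forall>\<kappa>\<in>A. \<forall>\<mu>\<in>A. \<forall>x \<in> chart_map \<kappa> ` (chart_dom \<kappa> \<inter> chart_dom \<mu>). \<forall>u v.
       let \<tau> = chart_trans \<kappa> \<mu>; D\<tau> = (\<lambda>y. frechet_derivative \<tau> (at y)) in
       D\<tau> x (\<Gamma> \<kappa> x u v) =
         frechet_derivative (\<lambda>y. D\<tau> y v) (at x) u + \<Gamma> \<mu> (\<tau> x) (D\<tau> x u) (D\<tau> x v))"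

definition torsion_free ::
  "('a, 'e::euclidean_space) chart set \<Rightarrow> ('a, 'e) christoffel \<Rightarrow> bool"
  where "torsion_free A \<Gamma> \<longleftrightarrow>
    (\<forall>\<kappa>\<in>A. \<forall>x\<in>chart_range \<kappa>. \<forall>u v. \<Gamma> \<kappa> x u v = \<Gamma> \<kappa> x v u)"

definition metric_compatible ::
  "('a, 'e::euclidean_space) chart set \<Rightarrow> ('a, 'e) metric \<Rightarrow> ('a, 'e) christoffel \<Rightarrow> bool"
  where "metric_compatible A g \<Gamma> \<longleftrightarrow>
    (\<forall>\<kappa>\<in>A. \<forall>x\<in>chart_range \<kappa>. \<forall>u v w.
       frechet_derivative (\<lambda>y. local_metric A g \<kappa> y v w) (at x) u =
         local_metric A g \<kappa> x (\<Gamma> \<kappa> x u v) w + local_metric A g \<kappa> x v (\<Gamma> \<kappa> x u w))"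

definition levi_civita ::
  "('a, 'e::euclidean_space) chart set \<Rightarrow> ('a, 'e) metric \<Rightarrow> ('a, 'e) christoffel \<Rightarrow> bool"
  where "levi_civita A g \<Gamma> \<longleftrightarrow>
    affine_connection A \<Gamma> \<and> torsion_free A \<Gamma> \<and> metric_compatible A g \<Gamma>"

section \<open>Immersed curves and vector fields along them\<close>

definition smooth_curve ::
  "'a topology \<Rightarrow> ('a, 'e::euclidean_space) chart set \<Rightarrow> (real \<Rightarrow> 'a) \<Rightarrow> bool"
  where "smooth_curve X A c \<longleftrightarrow>
    continuous_map (top_of_set {0..1}) X c \<and>
    (\<forall>\<kappa>\<in>A. smooth_on {t\<in>{0..1}. c t \<in> chart_dom \<kappa>} (chart_map \<kappa> \<circ> c))"

definition velocity ::
  "('a, 'e::euclidean_space) chart set \<Rightarrow> (real \<Rightarrow> 'a) \<Rightarrow> real \<Rightarrow> ('a, 'e) tvec"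
  where "velocity A c t = (\<lambda>\<kappa>. if \<kappa> \<in> charts_at A (c t)
    then vector_derivative (chart_map \<kappa> \<circ> c) (at t within {0..1}) else 0)"

definition Imm :: "'a topology \<Rightarrow> ('a, 'e::euclidean_space) chart set \<Rightarrow> (real \<Rightarrow> 'a) set"
  where "Imm X A = {c \<in> extensional {0..1}.
    smooth_curve X A c \<and> (\<forall>t\<in>{0..1}. velocity A c t \<noteq> 0)}"

text \<open>Vector fields along \<open>c\<close> are extended by \<open>0\<close> outside \<open>[0,1]\<close>.\<close>

definition tangent_Imm ::
  "('a, 'e::euclidean_space) chart set \<Rightarrow> (real \<Rightarrow> 'a) \<Rightarrow> (real \<Rightarrow> ('a, 'e) tvec) set"
  where "tangent_Imm A c = {h.
    (\<forall>t\<in>{0..1}. h t \<in> tangent_space A (c t)) \<and> (\<forall>t. t \<notin> {0..1} \<longrightarrow> h t = 0) \<and>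
    (\<forall>\<kappa>\<in>A. smooth_on {t\<in>{0..1}. c t \<in> chart_dom \<kappa>} (\<lambda>t. h t \<kappa>))}"

text \<open>The covariant derivative of \<open>h\<close> along \<open>c\<close>, that is \<open>\<nabla>\<^bsub>c'\<^esub> h\<close>.\<close>

definition cov_deriv ::
  "('a, 'e::euclidean_space) chart set \<Rightarrow> ('a, 'e) christoffel \<Rightarrow>
    (real \<Rightarrow> 'a) \<Rightarrow> (real \<Rightarrow> ('a, 'e) tvec) \<Rightarrow> real \<Rightarrow> ('a, 'e) tvec"
  where "cov_deriv A \<Gamma> c h t = (\<lambda>\<kappa>. if \<kappa> \<in> charts_at A (c t)
    then vector_derivative (\<lambda>s. h s \<kappa>) (at t within {0..1}) +
      \<Gamma> \<kappa> (chart_map \<kappa> (c t)) (velocity A c t \<kappa>) (h t \<kappa>)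
    else 0)"

definition parallel_fields ::
  "('a, 'e::euclidean_space) chart set \<Rightarrow> ('a, 'e) christoffel \<Rightarrow>
    (real \<Rightarrow> 'a) \<Rightarrow> (real \<Rightarrow> ('a, 'e) tvec) set"
  where "parallel_fields A \<Gamma> c =
    {h \<in> tangent_Imm A c. \<forall>t\<in>{0..1}. cov_deriv A \<Gamma> c h t = 0}"

section \<open>The metric on the space of immersed curves\<close>

definition speed ::
  "('a, 'e::euclidean_space) chart set \<Rightarrow> ('a, 'e) metric \<Rightarrow> (real \<Rightarrow> 'a) \<Rightarrow> real \<Rightarrow> real"
  where "speed A g c t = sqrt (g (c t) (velocity A c t) (velocity A c t))"

definition unit_tangent ::
  "('a, 'e::euclidean_space) chart set \<Rightarrow> ('a, 'e) metric \<Rightarrow>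
    (real \<Rightarrow> 'a) \<Rightarrow> real \<Rightarrow> ('a, 'e) tvec"
  where "unit_tangent A g c t = (1 / speed A g c t) *\<^sub>R velocity A c t"

definition arc_deriv ::
  "('a, 'e::euclidean_space) chart set \<Rightarrow> ('a, 'e) metric \<Rightarrow> ('a, 'e) christoffel \<Rightarrow>
    (real \<Rightarrow> 'a) \<Rightarrow> (real \<Rightarrow> ('a, 'e) tvec) \<Rightarrow> real \<Rightarrow> ('a, 'e) tvec"
  where "arc_deriv A g \<Gamma> c h t = (1 / speed A g c t) *\<^sub>R cov_deriv A \<Gamma> c h t"

definition arc_deriv_tan ::
  "('a, 'e::euclidean_space) chart set \<Rightarrow> ('a, 'e) metric \<Rightarrow> ('a, 'e) christoffel \<Rightarrow>
    (real \<Rightarrow> 'a) \<Rightarrow> (real \<Rightarrow> ('a, 'e) tvec) \<Rightarrow> real \<Rightarrow> ('a, 'e) tvec"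
  where "arc_deriv_tan A g \<Gamma> c h t =
    g (c t) (arc_deriv A g \<Gamma> c h t) (unit_tangent A g c t) *\<^sub>R unit_tangent A g c t"

definition arc_deriv_nor ::
  "('a, 'e::euclidean_space) chart set \<Rightarrow> ('a, 'e) metric \<Rightarrow> ('a, 'e) christoffel \<Rightarrow>
    (real \<Rightarrow> 'a) \<Rightarrow> (real \<Rightarrow> ('a, 'e) tvec) \<Rightarrow> real \<Rightarrow> ('a, 'e) tvec"
  where "arc_deriv_nor A g \<Gamma> c h t = arc_deriv A g \<Gamma> c h t - arc_deriv_tan A g \<Gamma> c h t"

definition G_metric ::
  "('a, 'e::euclidean_space) chart set \<Rightarrow> ('a, 'e) metric \<Rightarrow> ('a, 'e) christoffel \<Rightarrow>
    (real \<Rightarrow> 'a) \<Rightarrow> (real \<Rightarrow> ('a, 'e) tvec) \<Rightarrow> (real \<Rightarrow> ('a, 'e) tvec) \<Rightarrow> real"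
  where "G_metric A g \<Gamma> c h k = g (c 0) (h 0) (k 0) +
    integral {0..1} (\<lambda>t.
      (g (c t) (arc_deriv_nor A g \<Gamma> c h t) (arc_deriv_nor A g \<Gamma> c k t) +
       1/4 * g (c t) (arc_deriv_tan A g \<Gamma> c h t) (arc_deriv_tan A g \<Gamma> c k t)) *
      speed A g c t)"

section \<open>The base point projection\<close>

definition base_proj :: "(real \<Rightarrow> 'a) \<Rightarrow> 'a"
  where "base_proj c = c 0"

definition base_proj_deriv :: "(real \<Rightarrow> ('a, 'e) tvec) \<Rightarrow> ('a, 'e) tvec"
  where "base_proj_deriv h = h 0"

definition vertical ::
  "('a, 'e::euclidean_space) chart set \<Rightarrow> (real \<Rightarrow> 'a) \<Rightarrow> (real \<Rightarrow> ('a, 'e) tvec) set"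
  where "vertical A c = {h \<in> tangent_Imm A c. base_proj_deriv h = 0}"

definition horizontal ::
  "('a, 'e::euclidean_space) chart set \<Rightarrow> ('a, 'e) metric \<Rightarrow> ('a, 'e) christoffel \<Rightarrow>
    (real \<Rightarrow> 'a) \<Rightarrow> (real \<Rightarrow> ('a, 'e) tvec) set"
  where "horizontal A g \<Gamma> c =
    {h \<in> tangent_Imm A c. \<forall>k\<in>vertical A c. G_metric A g \<Gamma> c h k = 0}"

definition orthogonal_direct_sum ::
  "('v::real_vector \<Rightarrow> 'v \<Rightarrow> real) \<Rightarrow> 'v set \<Rightarrow> 'v set \<Rightarrow> 'v set \<Rightarrow> bool"
  where "orthogonal_direct_sum b T V H \<longleftrightarrow>
    subspace T \<and> subspace V \<and> subspace H \<and>
    V \<inter> H = {0} \<and> {v + w |v w. v \<in> V \<and> w \<in> H} = T \<and>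
    (\<forall>v\<in>V. \<forall>w\<in>H. b v w = 0)"

definition linear_isometry_onto ::
  "('v::real_vector \<Rightarrow> 'w::real_vector) \<Rightarrow> 'v set \<Rightarrow> ('v \<Rightarrow> 'v \<Rightarrow> real) \<Rightarrow>
    'w set \<Rightarrow> ('w \<Rightarrow> 'w \<Rightarrow> real) \<Rightarrow> bool"
  where "linear_isometry_onto f V b W b' \<longleftrightarrow>
    (\<forall>x\<in>V. \<forall>y\<in>V. f (x + y) = f x + f y) \<and>
    (\<forall>a. \<forall>x\<in>V. f (a *\<^sub>R x) = a *\<^sub>R f x) \<and>
    (\<forall>x\<in>V. \<forall>y\<in>V. b' (f x) (f y) = b x y) \<and>
    bij_betw f V W"

end

theory Submission
  imports Defs
begin

text \<open>
  Along an immersed curve every tangent vector at \<open>c(0)\<close> extends to a unique parallel field, since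
  in a chart the equation is a linear ODE and \<open>[0,1]\<close> is covered by finitely many charts.
  Parallel fields are orthogonal to the fields vanishing at \<open>0\<close>, because \<open>G\<close> sees a field only
  through its value at \<open>0\<close> and its covariant derivative. Conversely, let \<open>h\<close> be horizontal, let \<open>p\<close> be
  the parallel field with \<open>p(0) = h(0)\<close>, and put \<open>k = h - p\<close>. Then \<open>h\<close> and \<open>k\<close> have the same covariant
  derivative, so \<open>0 = G(h, k)\<close> is the integral of a continuous nonnegative function that
  vanishes only where \<open>\<nabla>k = 0\<close>; hence \<open>h\<close> is parallel. Evaluation at \<open>0\<close> is then the isometry.
\<close>

text \<open>In an infinite-dimensional inner product space that is not complete, a subspace and its
  orthogonal complement need not span. The splitting therefore has to be exhibited: the parallel
  field with the same initial value is the explicit horizontal summand, and only afterwards is the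
  orthogonal complement identified.

  The obstacle on the way is that no global coordinates exist. A field along the curve is a family
  of chart representatives, each smooth only on the relatively open set of times spent in its chart,
  with one-sided derivatives at 0 and 1. Derivatives within \<open>[0,1]\<close>, within
  subintervals and within such sets of times must constantly be identified, and the parallel
  equation is demanded in all charts at once, which is consistent because of the transformation rule
  of the Christoffel maps.

  Solutions come from Banach's fixed point theorem on intervals with \<open>L * (b - a) < 1\<close>.
  Since the equation is linear, this length does not depend on the initial vector, so bisection can
  join the pieces over all of \<open>[0,1]\<close>. Smoothness of the result is read off from the
  equation itself.\<close>

lemma linear_eq_sum_Basis:
  fixes f :: "'e::euclidean_space \<Rightarrow> 'b::real_vector"
  assumes "linear f"
  shows "f w = (\<Sum>b\<in>Basis. (w \<bullet> b) *\<^sub>R f b)"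
proof -
  have "f w = f (\<Sum>b\<in>Basis. (w \<bullet> b) *\<^sub>R b)"
    by (simp add: euclidean_representation)
  also have "\<dots> = (\<Sum>b\<in>Basis. (w \<bullet> b) *\<^sub>R f b)"
    by (simp add: linear_sum[OF assms] linear_scale[OF assms])
  finally show ?thesis .
qed

lemma bilinear_eq_sum_Basis:
  fixes f :: "'e::euclidean_space \<Rightarrow> 'd::euclidean_space \<Rightarrow> 'b::real_vector"
  assumes "bilinear f"
  shows "f u v = (\<Sum>a\<in>Basis. \<Sum>b\<in>Basis. ((u \<bullet> a) * (v \<bullet> b)) *\<^sub>R f a b)"
proof -
  have "f u v = (\<Sum>a\<in>Basis. (u \<bullet> a) *\<^sub>R f a v)"
    using assms linear_eq_sum_Basis[of "\<lambda>u. f u v" u] by (simp add: bilinear_def)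
  also have "\<dots> = (\<Sum>a\<in>Basis. (u \<bullet> a) *\<^sub>R (\<Sum>b\<in>Basis. (v \<bullet> b) *\<^sub>R f a b))"
    using assms linear_eq_sum_Basis[of "f _" v] by (simp add: bilinear_def)
  also have "\<dots> = (\<Sum>a\<in>Basis. \<Sum>b\<in>Basis. ((u \<bullet> a) * (v \<bullet> b)) *\<^sub>R f a b)"
    by (simp add: scaleR_sum_right)
  finally show ?thesis .
qed

text \<open>The hypotheses on connection and metric give regularity only for fixed vector arguments.
  In finite dimension this already yields joint continuity: expand the moving argument in the basis.
  The bilinear analogue serves the metric.\<close>

lemma continuous_on_linear_family:
  fixes B :: "'t::topological_space \<Rightarrow> 'e::euclidean_space \<Rightarrow> 'b::real_normed_vector"
  assumes "\<And>t. t \<in> S \<Longrightarrow> linear (B t)" "\<And>b. continuous_on S (\<lambda>t. B t b)" "continuous_on S u"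
  shows "continuous_on S (\<lambda>t. B t (u t))"
proof -
  have "continuous_on S (\<lambda>t. \<Sum>b\<in>Basis. (u t \<bullet> b) *\<^sub>R B t b)"
    by (intro continuous_intros assms)
  then show ?thesis
    by (rule continuous_on_cong[THEN iffD1, rotated -1]) (auto simp: linear_eq_sum_Basis[OF assms(1), symmetric])
qed

lemma continuous_on_bilinear_family:
  fixes f :: "'t::topological_space \<Rightarrow> 'e::euclidean_space \<Rightarrow> 'd::euclidean_space \<Rightarrow> 'b::real_normed_vector"
  assumes "\<And>t. t \<in> S \<Longrightarrow> bilinear (f t)" "\<And>a b. continuous_on S (\<lambda>t. f t a b)"
    and "continuous_on S u" "continuous_on S v"
  shows "continuous_on S (\<lambda>t. f t (u t) (v t))"
proof -
  have "continuous_on S (\<lambda>t. \<Sum>a\<in>Basis. \<Sum>b\<in>Basis. ((u t \<bullet> a) * (v t \<bullet> b)) *\<^sub>R f t a b)"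
    by (intro continuous_intros assms)
  then show ?thesis
    by (rule continuous_on_cong[THEN iffD1, rotated -1])
      (auto simp: bilinear_eq_sum_Basis[OF assms(1), symmetric])
qed

section \<open>Linear ordinary differential equations\<close>

text \<open>Picard's integral operator is a contraction with constant \<open>L * (b - a)\<close>.
  Restricting to short intervals is harmless because solutions are glued later; derivatives are
  within \<open>{a..b}\<close>, hence one-sided at the ends, which is the form that gluing
  needs.\<close>

lemma linear_ode_exists:
  fixes B :: "real \<Rightarrow> 'e::euclidean_space \<Rightarrow> 'e"
  assumes ab: "a \<le> b"
    and lin: "\<And>t. t \<in> {a..b} \<Longrightarrow> linear (B t)"
    and cont: "\<And>w. continuous_on {a..b} (\<lambda>t. B t w)"
    and bound: "\<And>t w. t \<in> {a..b} \<Longrightarrow> norm (B t w) \<le> L * norm w"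
    and short: "0 \<le> L" "L * (b - a) < 1"
  shows "\<exists>u. u a = u0 \<and> (\<forall>t\<in>{a..b}. (u has_vector_derivative B t (u t)) (at t within {a..b}))"
proof -
  define \<Phi> where "\<Phi> u t = u0 + integral {a..t} (\<lambda>s. B s (u s))" for u t
  \<comment> \<open>Banach's theorem is applied on the type of bounded continuous functions on the
    whole line, so the Picard iterate is extended from \<open>[a,b]\<close> by its endpoint
    values.\<close>
  define F where "F u = Bcontfun (ext_cont (\<Phi> (apply_bcontfun u)) a b)" for u
  have cB: "continuous_on {a..b} (\<lambda>s. B s (u s))" if "continuous_on {a..b} u" for u
    by (rule continuous_on_linear_family) (use lin cont that in auto)
  have c\<Phi>: "continuous_on {a..b} (\<Phi> u)" if "continuous_on {a..b} u" for u
    unfolding \<Phi>_def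
    by (intro continuous_intros indefinite_integral_continuous_1 integrable_continuous_real cB that)
  have "ext_cont (\<Phi> (apply_bcontfun u)) a b \<in> bcontfun" for u
  proof -
    have *: "continuous_on (cbox a b) (\<Phi> (apply_bcontfun u))"
      using c\<Phi>[of "apply_bcontfun u"] by simp
    show ?thesis
      unfolding bcontfun_def ext_cont_def mem_Collect_eq
      by (intro conjI clamp_continuous_on[OF *] clamp_bounded
          compact_imp_bounded[OF compact_continuous_image] * compact_cbox)
  qed
  then have apply_F: "apply_bcontfun (F u) = ext_cont (\<Phi> (apply_bcontfun u)) a b" for u
    by (simp add: F_def Bcontfun_inverse)
  have "\<exists>!u. F u = u"
  proof (rule banach_fix_type)
    show "0 \<le> L * (b - a)" using ab short by simp
    show "L * (b - a) < 1" by fact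
    show "\<forall>x y. dist (F x) (F y) \<le> L * (b - a) * dist x y"
    proof (intro allI dist_bound)
      fix x y :: "real \<Rightarrow>\<^sub>C 'e" and t
      \<comment> \<open>Clamping reduces the supremum distance over the whole line to times in
        \<open>[a,b]\<close>, where the integral estimate applies.\<close>
      define s where "s = clamp a b t"
      have s: "s \<in> {a..b}" unfolding s_def using clamp_in_interval[of a b t] ab by simp
      have int: "(\<lambda>r. B r (apply_bcontfun z r)) integrable_on {a..s}" for z
        using s by (intro integrable_continuous_real continuous_on_subset[OF cB]) auto
      have "dist (F x t) (F y t) = norm (integral {a..s} (\<lambda>r. B r (x r)) - integral {a..s} (\<lambda>r. B r (y r)))"
        by (simp add: apply_F ext_cont_def \<Phi>_def s_def dist_norm)
      also have "\<dots> = norm (integral {a..s} (\<lambda>r. B r (x r) - B r (y r)))"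
        by (simp add: Henstock_Kurzweil_Integration.integral_diff int)
      also have "\<dots> \<le> (L * dist x y) * (s - a)"
      proof (rule integral_bound)
        show "a \<le> s" using s by simp
        show "continuous_on {a..s} (\<lambda>r. B r (x r) - B r (y r))"
          using s by (intro continuous_intros continuous_on_subset[OF cB]) auto
        fix r assume r: "r \<in> {a..s}"
        then have "B r (x r) - B r (y r) = B r (x r - y r)"
          using s linear_diff[OF lin] by simp
        also have "norm \<dots> \<le> L * norm (x r - y r)"
          using r s by (intro bound) simp
        also have "\<dots> \<le> L * dist x y"
          using dist_bounded[of x r y] short by (simp add: dist_norm mult_left_mono)
        finally show "norm (B r (x r) - B r (y r)) \<le> L * dist x y" .
      qed
      also have "\<dots> \<le> (L * dist x y) * (b - a)"
        using s short by (intro mult_left_mono) auto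
      finally show "dist (F x t) (F y t) \<le> L * (b - a) * dist x y"
        by (simp add: algebra_simps)
    qed
  qed
  then obtain u where u: "F u = u" by auto
  have u_eq: "u t = \<Phi> u t" if "t \<in> {a..b}" for t
  proof -
    have "u t = F u t" by (simp add: u)
    then show ?thesis using that by (simp add: apply_F)
  qed
  have deriv: "(apply_bcontfun u has_vector_derivative B t (u t)) (at t within {a..b})" if t: "t \<in> {a..b}" for t
  proof (rule has_vector_derivative_transform[OF t u_eq])
    show "((\<lambda>t. \<Phi> u t) has_vector_derivative B t (u t)) (at t within {a..b})"
      unfolding \<Phi>_def
      by (rule derivative_eq_intros integral_has_vector_derivative cB refl t | simp)+
  qed auto
  moreover have "u a = u0"
    using u_eq[of a] ab by (simp add: \<Phi>_def)
  ultimately show ?thesis by blast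
qed

text \<open>With \<open>\<parallel>B\<parallel> \<le> L\<close>, the function \<open>e\<^bsup>-2Lt\<^esup> \<parallel>y(t)\<parallel>\<^sup>2\<close> is nonincreasing.\<close>

lemma linear_ode_unique:
  fixes y :: "real \<Rightarrow> 'e::real_inner"
  assumes deriv: "\<And>t. t \<in> {a..b} \<Longrightarrow> (y has_vector_derivative B t (y t)) (at t within {a..b})"
    and bound: "\<And>t w. t \<in> {a..b} \<Longrightarrow> norm (B t w) \<le> L * norm w"
    and "y a = 0" and t: "t \<in> {a..b}"
  shows "y t = 0"
proof -
  define f where "f t = exp (- 2 * L * t) * (y t \<bullet> y t)" for t
  have cy: "continuous_on {a..b} y"
    by (rule has_derivative_continuous_on[OF deriv[unfolded has_vector_derivative_def]])
  have "f t \<le> f a"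
  proof (rule DERIV_nonpos_imp_decreasing_open[where f = f and a = a and b = t])
    show "a \<le> t" using t by simp
    show "continuous_on {a..t} f" unfolding f_def
      using t by (intro continuous_intros continuous_on_subset[OF cy]) auto
    fix x assume x: "a < x" "x < t"
    then have xin: "x \<in> {a<..<b}" "x \<in> {a..b}" using t by auto
    have dy: "(y has_derivative (\<lambda>s. s *\<^sub>R B x (y x))) (at x)"
      using deriv[OF xin(2)] xin(1) by (simp add: at_within_Icc_at has_vector_derivative_def)
    have "(f has_derivative (\<lambda>s. s * (exp (- 2 * L * x) * (2 * (y x \<bullet> B x (y x)) - 2 * L * (y x \<bullet> y x))))) (at x)"
      unfolding f_def
      by (rule derivative_eq_intros dy refl | simp add: algebra_simps inner_commute)+
    then have "(f has_field_derivative exp (- 2 * L * x) * (2 * (y x \<bullet> B x (y x)) - 2 * L * (y x \<bullet> y x))) (at x)"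
      by (simp add: has_field_derivative_def mult_commute_abs)
    moreover have "y x \<bullet> B x (y x) \<le> L * (y x \<bullet> y x)"
    proof -
      have "y x \<bullet> B x (y x) \<le> norm (y x) * norm (B x (y x))" by (rule norm_cauchy_schwarz)
      also have "\<dots> \<le> norm (y x) * (L * norm (y x))"
        using bound[OF xin(2)] by (intro mult_left_mono) auto
      finally show ?thesis by (simp add: dot_square_norm power2_eq_square algebra_simps)
    qed
    then have "exp (- 2 * L * x) * (2 * (y x \<bullet> B x (y x)) - 2 * L * (y x \<bullet> y x)) \<le> 0"
      by (intro mult_nonneg_nonpos) auto
    ultimately show "\<exists>d. DERIV f x :> d \<and> d \<le> 0" by blast
  qed
  then have "exp (- 2 * L * t) * (y t \<bullet> y t) \<le> 0" using \<open>y a = 0\<close> by (simp add: f_def)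
  then have "y t \<bullet> y t \<le> 0" by (simp add: mult_le_0_iff)
  then show ?thesis by (metis inner_ge_zero inner_eq_zero_iff order_antisym)
qed

section \<open>Smooth functions of a real variable\<close>

lemma Ck_on_Suc_imp: "Ck_on (Suc k) S f \<Longrightarrow> Ck_on k S f"
proof (induction k arbitrary: f)
  case 0
  then show ?case by (auto intro: differentiable_imp_continuous_on)
next
  case (Suc k)
  then show ?case by (auto simp del: Ck_on.simps simp: Ck_on.simps(2))
qed

lemma Ck_on_cong:
  assumes "\<And>x. x \<in> S \<Longrightarrow> f x = h x" "Ck_on k S f"
  shows "Ck_on k S h"
  using assms
proof (induction k arbitrary: f h)
  case 0
  then show ?case using continuous_on_cong[of S S f h] by auto
next
  case (Suc k)
  have *: "(f has_derivative D) (at x within S) \<longleftrightarrow> (h has_derivative D) (at x within S)" if "x \<in> S" for x D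
    using Suc.prems(1) that by (metis has_derivative_transform)
  \<comment> \<open>\<open>frechet_derivative\<close> is a choice among all derivatives, so equality
    of the two derivative predicates gives equal choices even at points where derivatives within
    \<open>S\<close> are not unique.\<close>
  then have "frechet_derivative f (at x within S) v = frechet_derivative h (at x within S) v" if "x \<in> S" for x v
    using that by (simp add: frechet_derivative_def)
  then have "Ck_on k S (\<lambda>x. frechet_derivative h (at x within S) v)" for v
    using Suc.IH[of "\<lambda>x. frechet_derivative f (at x within S) v"] Suc.prems(2) by simp
  then show ?case
    using Suc.prems * by (auto simp: differentiable_on_def differentiable_def) 
qed

text \<open>The condition that makes derivatives within \<open>S\<close> unique.\<close>

definition no_isolated :: "real set \<Rightarrow> bool"
  where "no_isolated S \<longleftrightarrow> (\<forall>t\<in>S. at t within S \<noteq> bot)"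

lemma frechet_derivative_eq_vector:
  fixes f :: "real \<Rightarrow> 'b::real_normed_vector"
  assumes "at t within S \<noteq> bot" "(f has_vector_derivative d) (at t within S)"
  shows "frechet_derivative f (at t within S) v = v *\<^sub>R d"
proof -
  have "f differentiable at t within S"
    using assms(2) by (rule differentiableI_vector)
  then have fd: "(f has_derivative frechet_derivative f (at t within S)) (at t within S)"
    by (simp add: frechet_derivative_works)
  then have lin: "linear (frechet_derivative f (at t within S))"
    by (rule has_derivative_linear)
  have eq: "frechet_derivative f (at t within S) v = v *\<^sub>R frechet_derivative f (at t within S) 1" for v
    using linear_scale[OF lin, of v 1] by simp
  have "(f has_vector_derivative frechet_derivative f (at t within S) 1) (at t within S)"
    unfolding has_vector_derivative_def
    by (rule has_derivative_eq_rhs[OF fd]) (rule ext, rule eq)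
  then have "frechet_derivative f (at t within S) 1 = d"
    using vector_derivative_unique_within[OF assms(1)] assms(2) by blast
  with eq show ?thesis by metis
qed

text \<open>For a function of one real variable the directions \<open>v\<close> are numbers, and the
  derivative in direction \<open>v\<close> is \<open>v\<close> times the vector derivative. The
  factor \<open>v\<close> is kept for now: removing it requires closure under scaling, whose proof
  is an induction through this very equivalence.\<close>

lemma Ck_on_Suc_iff:
  fixes f :: "real \<Rightarrow> 'b::real_normed_vector"
  assumes "no_isolated S"
  shows "Ck_on (Suc k) S f \<longleftrightarrow>
    (\<exists>f'. (\<forall>t\<in>S. (f has_vector_derivative f' t) (at t within S)) \<and> (\<forall>v. Ck_on k S (\<lambda>t. v *\<^sub>R f' t)))"
    (is "?L \<longleftrightarrow> ?R")
proof
  assume ?L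
  then have d: "f differentiable_on S"
    and k: "\<And>v. Ck_on k S (\<lambda>x. frechet_derivative f (at x within S) v)" by auto
  define f' where "f' t = vector_derivative f (at t within S)" for t
  have f': "(f has_vector_derivative f' t) (at t within S)" if "t \<in> S" for t
    unfolding f'_def using that d by (simp add: vector_derivative_works[symmetric] differentiable_on_def)
  have "Ck_on k S (\<lambda>t. v *\<^sub>R f' t)" for v
    by (rule Ck_on_cong[OF _ k[of v]])
      (use assms f' in \<open>simp add: no_isolated_def frechet_derivative_eq_vector\<close>)
  with f' show ?R by blast
next
  assume ?R
  then obtain f' where f': "\<And>t. t \<in> S \<Longrightarrow> (f has_vector_derivative f' t) (at t within S)"
    and k: "\<And>v. Ck_on k S (\<lambda>t. v *\<^sub>R f' t)" by blast
  have "Ck_on k S (\<lambda>x. frechet_derivative f (at x within S) v)" for v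
    by (rule Ck_on_cong[OF _ k[of v]])
      (use assms frechet_derivative_eq_vector[OF _ f'] in \<open>simp add: no_isolated_def\<close>)
  moreover have "f differentiable_on S"
    using f' by (auto simp: differentiable_on_def intro: differentiableI_vector)
  ultimately show ?L by simp
qed

lemma Ck_on_bounded_linear:
  fixes f :: "real \<Rightarrow> 'b::real_normed_vector"
  assumes S: "no_isolated S" and p: "bounded_linear p"
  shows "Ck_on k S f \<Longrightarrow> Ck_on k S (\<lambda>t. p (f t))"
proof (induction k arbitrary: f)
  case 0
  then show ?case by (auto intro: bounded_linear.continuous_on[OF p])
next
  case (Suc k)
  then obtain f' where f': "\<And>t. t \<in> S \<Longrightarrow> (f has_vector_derivative f' t) (at t within S)"
    and k: "\<And>v. Ck_on k S (\<lambda>t. v *\<^sub>R f' t)" using Ck_on_Suc_iff[OF S] by metis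
  have "((\<lambda>t. p (f t)) has_vector_derivative p (f' t)) (at t within S)" if "t \<in> S" for t
    by (rule bounded_linear.has_vector_derivative[OF p f'[OF that]])
  moreover have "Ck_on k S (\<lambda>t. v *\<^sub>R p (f' t))" for v
    using Suc.IH[OF k[of v]] by (simp add: linear_scale[OF bounded_linear.linear[OF p]])
  ultimately show ?case unfolding Ck_on_Suc_iff[OF S]
    by (intro exI[of _ "\<lambda>t. p (f' t)"]) auto
qed

text \<open>Scaling by \<open>v\<close> is a bounded linear map and therefore preserves
  \<open>Ck_on\<close>, while \<open>v = 1\<close> gives back \<open>f'\<close>. This is the
  recursion used from here on.\<close>

lemma Ck_on_Suc_iff_deriv:
  fixes f :: "real \<Rightarrow> 'b::real_normed_vector"
  assumes "no_isolated S"
  shows "Ck_on (Suc k) S f \<longleftrightarrow>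
    (\<exists>f'. (\<forall>t\<in>S. (f has_vector_derivative f' t) (at t within S)) \<and> Ck_on k S f')"
proof -
  have "(\<forall>v. Ck_on k S (\<lambda>t. v *\<^sub>R f' t)) \<longleftrightarrow> Ck_on k S f'" for f' :: "real \<Rightarrow> 'b"
    using Ck_on_bounded_linear[OF assms bounded_linear_scaleR_right]
    by (auto dest: spec[of _ 1])
  then show ?thesis unfolding Ck_on_Suc_iff[OF assms] by simp
qed

lemma Ck_on_const: "no_isolated S \<Longrightarrow> Ck_on k S (\<lambda>x. c)"
proof (induction k arbitrary: c)
  case (Suc k)
  then show ?case unfolding Ck_on_Suc_iff_deriv[OF Suc.prems]
    by (intro exI[of _ "\<lambda>t. 0"]) auto
qed simp

lemma Ck_on_add:
  fixes f h :: "real \<Rightarrow> 'b::real_normed_vector"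
  assumes S: "no_isolated S"
  shows "Ck_on k S f \<Longrightarrow> Ck_on k S h \<Longrightarrow> Ck_on k S (\<lambda>t. f t + h t)"
proof (induction k arbitrary: f h)
  case 0
  then show ?case by (auto intro: continuous_intros)
next
  case (Suc k)
  obtain f' h' where "\<And>t. t \<in> S \<Longrightarrow> (f has_vector_derivative f' t) (at t within S)" "Ck_on k S f'"
    "\<And>t. t \<in> S \<Longrightarrow> (h has_vector_derivative h' t) (at t within S)" "Ck_on k S h'"
    using Suc.prems unfolding Ck_on_Suc_iff_deriv[OF S] by blast
  then show ?case unfolding Ck_on_Suc_iff_deriv[OF S]
    by (intro exI[of _ "\<lambda>t. f' t + h' t"] conjI ballI has_vector_derivative_add Suc.IH)
qed

lemma Ck_on_sum:
  fixes f :: "'i \<Rightarrow> real \<Rightarrow> 'b::real_normed_vector"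
  assumes S: "no_isolated S" and "\<And>i. i \<in> I \<Longrightarrow> Ck_on k S (f i)"
  shows "Ck_on k S (\<lambda>t. \<Sum>i\<in>I. f i t)"
  using assms(2) by (induction I rule: infinite_finite_induct) (auto intro: Ck_on_add[OF S] Ck_on_const[OF S])

lemma Ck_on_bilinear:
  fixes f :: "real \<Rightarrow> 'b::real_normed_vector" and h :: "real \<Rightarrow> 'c::real_normed_vector"
  assumes S: "no_isolated S" and p: "bounded_bilinear p"
  shows "Ck_on k S f \<Longrightarrow> Ck_on k S h \<Longrightarrow> Ck_on k S (\<lambda>t. p (f t) (h t))"
proof (induction k arbitrary: f h)
  case 0
  then show ?case by (auto intro: bounded_bilinear.continuous_on[OF p])
next
  case (Suc k)
  obtain f' h' where d: "\<And>t. t \<in> S \<Longrightarrow> (f has_vector_derivative f' t) (at t within S)" "Ck_on k S f'"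
    "\<And>t. t \<in> S \<Longrightarrow> (h has_vector_derivative h' t) (at t within S)" "Ck_on k S h'"
    using Suc.prems unfolding Ck_on_Suc_iff_deriv[OF S] by blast
  show ?case unfolding Ck_on_Suc_iff_deriv[OF S]
    by (intro exI[of _ "\<lambda>t. p (f t) (h' t) + p (f' t) (h t)"] conjI ballI
        bounded_bilinear.has_vector_derivative[OF p] Ck_on_add[OF S] Suc.IH d Ck_on_Suc_imp[OF Suc.prems(1)]
        Ck_on_Suc_imp[OF Suc.prems(2)])
qed

text \<open>\<open>Ck_on\<close> controls derivatives of \<open>F\<close> in fixed directions only,
  whereas the chain rule differentiates in the moving direction \<open>x' t\<close>. Expanding
  \<open>x' t\<close> in the basis leaves the maps \<open>D b\<close>, to which the induction
  hypothesis, general in \<open>F\<close>, applies.\<close>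

lemma Ck_on_compose:
  fixes x :: "real \<Rightarrow> 'e::euclidean_space" and F :: "'e \<Rightarrow> 'b::real_normed_vector"
  assumes S: "no_isolated S" and U: "open U" "x ` S \<subseteq> U"
  shows "Ck_on k U F \<Longrightarrow> Ck_on k S x \<Longrightarrow> Ck_on k S (\<lambda>t. F (x t))"
proof (induction k arbitrary: F)
  case 0
  then show ?case using U by (auto intro: continuous_on_compose2)
next
  case (Suc k)
  define D where "D b y = frechet_derivative F (at y within U) b" for b y
  obtain x' where x': "\<And>t. t \<in> S \<Longrightarrow> (x has_vector_derivative x' t) (at t within S)" "Ck_on k S x'"
    using Suc.prems(2) unfolding Ck_on_Suc_iff_deriv[OF S] by blast
  have kD: "Ck_on k U (D b)" for b using Suc.prems(1) by (simp add: D_def[abs_def])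
  have dF: "(F has_derivative (\<lambda>b. D b y)) (at y within U)" if "y \<in> U" for y
    using Suc.prems(1) that by (auto simp: D_def[abs_def] differentiable_on_def frechet_derivative_works[symmetric])
  have "((\<lambda>t. F (x t)) has_vector_derivative (\<Sum>b\<in>Basis. (x' t \<bullet> b) *\<^sub>R D b (x t))) (at t within S)"
    if t: "t \<in> S" for t
  proof -
    have xt: "x t \<in> U" using t U by auto
    have "(F has_derivative (\<lambda>b. D b (x t))) (at (x t) within x ` S)"
      using has_derivative_subset[OF dF[OF xt] U(2)] .
    from vector_derivative_diff_chain_within[OF x'(1)[OF t] this]
    have "((\<lambda>t. F (x t)) has_vector_derivative D (x' t) (x t)) (at t within S)"
      by (simp add: o_def)
    moreover have "D (x' t) (x t) = (\<Sum>b\<in>Basis. (x' t \<bullet> b) *\<^sub>R D b (x t))"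
      by (rule linear_eq_sum_Basis[OF has_derivative_linear[OF dF[OF xt]]])
    ultimately show ?thesis by simp
  qed
  moreover have "Ck_on k S (\<lambda>t. (x' t \<bullet> b) *\<^sub>R D b (x t))" for b
    by (intro Ck_on_bilinear[OF S bounded_bilinear_scaleR]
        Ck_on_bounded_linear[OF S bounded_linear_inner_left] x' Suc.IH kD Ck_on_Suc_imp[OF Suc.prems(2)])
  ultimately show ?case unfolding Ck_on_Suc_iff_deriv[OF S]
    by (intro exI[of _ "\<lambda>t. \<Sum>b\<in>Basis. (x' t \<bullet> b) *\<^sub>R D b (x t)"] conjI ballI Ck_on_sum[OF S]) auto
qed

section \<open>Charts and tangent vectors\<close>

locale atlas =
  fixes X :: "'a topology" and A :: "('a, 'e::euclidean_space) chart set"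
  assumes smooth_manifold: "smooth_manifold X A"
begin

definition overlap :: "('a, 'e) chart \<Rightarrow> ('a, 'e) chart \<Rightarrow> 'e set"
  where "overlap \<kappa> \<mu> = chart_map \<kappa> ` (chart_dom \<kappa> \<inter> chart_dom \<mu>)"

definition dtrans :: "('a, 'e) chart \<Rightarrow> ('a, 'e) chart \<Rightarrow> 'e \<Rightarrow> 'e \<Rightarrow> 'e"
  where "dtrans \<kappa> \<mu> x = frechet_derivative (chart_trans \<kappa> \<mu>) (at x)"

lemma charts_atD: "\<kappa> \<in> charts_at A p \<Longrightarrow> \<kappa> \<in> A" "\<kappa> \<in> charts_at A p \<Longrightarrow> p \<in> chart_dom \<kappa>"
  by (auto simp: charts_at_def)

lemma charts_at_nonempty: "p \<in> topspace X \<Longrightarrow> \<exists>\<kappa>. \<kappa> \<in> charts_at A p"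
  using smooth_manifold unfolding smooth_manifold_def charts_at_def by blast

lemma openin_chart_dom: "\<kappa> \<in> A \<Longrightarrow> openin X (chart_dom \<kappa>)"
  and open_chart_range: "\<kappa> \<in> A \<Longrightarrow> open (chart_range \<kappa>)"
  and homeomorphic_chart: "\<kappa> \<in> A \<Longrightarrow>
    homeomorphic_map (subtopology X (chart_dom \<kappa>)) (top_of_set (chart_range \<kappa>)) (chart_map \<kappa>)"
  and smooth_trans: "\<kappa> \<in> A \<Longrightarrow> \<mu> \<in> A \<Longrightarrow> smooth_on (overlap \<kappa> \<mu>) (chart_trans \<kappa> \<mu>)"
  using smooth_manifold by (auto simp: smooth_manifold_def overlap_def)

lemma topspace_chart: "\<kappa> \<in> A \<Longrightarrow> topspace (subtopology X (chart_dom \<kappa>)) = chart_dom \<kappa>"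
  using openin_subset[OF openin_chart_dom[of \<kappa>]] by (simp add: topspace_subtopology Int_absorb1)

lemma inj_on_chart: "\<kappa> \<in> A \<Longrightarrow> inj_on (chart_map \<kappa>) (chart_dom \<kappa>)"
  using homeomorphic_imp_injective_map[OF homeomorphic_chart[of \<kappa>]] by (simp only: topspace_chart)

lemma chart_inv_map: "\<kappa> \<in> charts_at A p \<Longrightarrow> chart_inv \<kappa> (chart_map \<kappa> p) = p"
  by (simp add: chart_inv_def charts_at_def inv_into_f_f inj_on_chart)

lemma chart_trans_map: "\<kappa> \<in> charts_at A p \<Longrightarrow> chart_trans \<kappa> \<mu> (chart_map \<kappa> p) = chart_map \<mu> p"
  by (simp add: chart_trans_def chart_inv_map)

lemma open_overlap:
  assumes "\<kappa> \<in> A" "\<mu> \<in> A"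
  shows "open (overlap \<kappa> \<mu>)"
proof -
  have "openin (subtopology X (chart_dom \<kappa>)) (chart_dom \<kappa> \<inter> chart_dom \<mu>)"
    using openin_chart_dom[OF assms(2)] by (auto simp: openin_subtopology)
  then have "openin (top_of_set (chart_range \<kappa>)) (overlap \<kappa> \<mu>)"
    unfolding overlap_def
    using homeomorphic_imp_open_map[OF homeomorphic_chart[OF assms(1)]] by (simp add: open_map_def)
  then show ?thesis
    using open_chart_range[OF assms(1)] openin_open_eq by blast
qed

lemma overlap_mem: "\<kappa> \<in> charts_at A p \<Longrightarrow> \<mu> \<in> charts_at A p \<Longrightarrow> chart_map \<kappa> p \<in> overlap \<kappa> \<mu>"
  by (auto simp: overlap_def charts_at_def)

lemma overlapE:
  assumes "x \<in> overlap \<kappa> \<mu>" "\<kappa> \<in> A" "\<mu> \<in> A"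
  obtains p where "x = chart_map \<kappa> p" "\<kappa> \<in> charts_at A p" "\<mu> \<in> charts_at A p"
  using assms by (auto simp: overlap_def charts_at_def)

text \<open>Smoothness of transition maps is phrased with derivatives within the overlap, tangent
  vectors with derivatives at a point; openness of the overlap identifies the two.\<close>

lemma at_within_overlap:
  assumes "\<kappa> \<in> A" "\<mu> \<in> A" "x \<in> overlap \<kappa> \<mu>"
  shows "at x within overlap \<kappa> \<mu> = at x"
  by (rule at_within_open[OF assms(3) open_overlap[OF assms(1,2)]])

lemma has_derivative_trans:
  assumes "\<kappa> \<in> A" "\<mu> \<in> A" "x \<in> overlap \<kappa> \<mu>"
  shows "(chart_trans \<kappa> \<mu> has_derivative dtrans \<kappa> \<mu> x) (at x)"
proof -
  have "Ck_on (Suc 0) (overlap \<kappa> \<mu>) (chart_trans \<kappa> \<mu>)"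
    using smooth_trans[OF assms(1,2)] unfolding smooth_on_def by blast
  then have "chart_trans \<kappa> \<mu> differentiable at x"
    using assms at_within_overlap[OF assms] by (auto simp: differentiable_on_def)
  then show ?thesis by (simp add: dtrans_def frechet_derivative_works[symmetric])
qed

lemma linear_dtrans: "\<kappa> \<in> A \<Longrightarrow> \<mu> \<in> A \<Longrightarrow> x \<in> overlap \<kappa> \<mu> \<Longrightarrow> linear (dtrans \<kappa> \<mu> x)"
  by (rule has_derivative_linear[OF has_derivative_trans])

text \<open>The second derivative of the transition map exists, which gives meaning to the
  inhomogeneous term in the transformation rule of \<open>\<Gamma>\<close>.\<close>

lemma dtrans_differentiable:
  assumes "\<kappa> \<in> A" "\<mu> \<in> A" "x \<in> overlap \<kappa> \<mu>"
  shows "(\<lambda>y. dtrans \<kappa> \<mu> y v) differentiable at x"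
proof -
  have "Ck_on (Suc (Suc 0)) (overlap \<kappa> \<mu>) (chart_trans \<kappa> \<mu>)"
    using smooth_trans[OF assms(1,2)] unfolding smooth_on_def by blast
  then have "(\<lambda>y. frechet_derivative (chart_trans \<kappa> \<mu>) (at y within overlap \<kappa> \<mu>) v) differentiable_on overlap \<kappa> \<mu>"
    by simp
  then obtain D where "((\<lambda>y. frechet_derivative (chart_trans \<kappa> \<mu>) (at y within overlap \<kappa> \<mu>) v) has_derivative D) (at x)"
    using assms at_within_overlap[OF assms] by (auto simp: differentiable_on_def differentiable_def)
  then have "((\<lambda>y. dtrans \<kappa> \<mu> y v) has_derivative D) (at x)"
    by (rule has_derivative_transform_within_open[OF _ open_overlap[OF assms(1,2)] assms(3)])
      (use assms at_within_overlap in \<open>simp add: dtrans_def\<close>)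
  then show ?thesis by (auto simp: differentiable_def)
qed

lemma dtrans_self:
  assumes "\<kappa> \<in> charts_at A p"
  shows "dtrans \<kappa> \<kappa> (chart_map \<kappa> p) = id"
proof -
  let ?x = "chart_map \<kappa> p"
  have A: "\<kappa> \<in> A" and x: "?x \<in> overlap \<kappa> \<kappa>" using assms charts_atD overlap_mem by auto
  have "(id has_derivative dtrans \<kappa> \<kappa> ?x) (at ?x)"
    by (rule has_derivative_transform_within_open[OF has_derivative_trans[OF A A x] open_overlap[OF A A] x])
      (auto elim!: overlapE[OF _ A A] simp: chart_trans_map)
  then show ?thesis
    using has_derivative_unique[OF _ has_derivative_id] by blast
qed

text \<open>The cocycle identity, by the chain rule. The composite of two transitions equals the
  direct one on an open set around the point, which is enough for derivatives. It makes a vector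
  prescribed in one chart consistent in all others.\<close>

lemma dtrans_trans:
  assumes "\<kappa> \<in> charts_at A p" "\<mu> \<in> charts_at A p" "\<nu> \<in> charts_at A p"
  shows "dtrans \<mu> \<nu> (chart_map \<mu> p) (dtrans \<kappa> \<mu> (chart_map \<kappa> p) u) = dtrans \<kappa> \<nu> (chart_map \<kappa> p) u"
proof -
  let ?x = "chart_map \<kappa> p"
  note A = assms[THEN charts_atD(1)]
  have x: "?x \<in> overlap \<kappa> \<mu> \<inter> overlap \<kappa> \<nu>" and y: "chart_trans \<kappa> \<mu> ?x \<in> overlap \<mu> \<nu>"
    using assms overlap_mem by (auto simp: chart_trans_map)
  have "(chart_trans \<mu> \<nu> \<circ> chart_trans \<kappa> \<mu> has_derivative
      dtrans \<mu> \<nu> (chart_trans \<kappa> \<mu> ?x) \<circ> dtrans \<kappa> \<mu> ?x) (at ?x)"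
    using x y A by (intro diff_chain_at has_derivative_trans) auto
  then have "(chart_trans \<kappa> \<nu> has_derivative
      dtrans \<mu> \<nu> (chart_trans \<kappa> \<mu> ?x) \<circ> dtrans \<kappa> \<mu> ?x) (at ?x)"
  proof (rule has_derivative_transform_within_open)
    show "open (overlap \<kappa> \<mu> \<inter> overlap \<kappa> \<nu>)" using A open_overlap by blast
    fix z assume "z \<in> overlap \<kappa> \<mu> \<inter> overlap \<kappa> \<nu>"
    then obtain q where q: "z = chart_map \<kappa> q" "\<kappa> \<in> charts_at A q" "\<mu> \<in> charts_at A q"
      using overlapE[OF _ A(1,2)] by blast
    then show "(chart_trans \<mu> \<nu> \<circ> chart_trans \<kappa> \<mu>) z = chart_trans \<kappa> \<nu> z"
      by (simp add: chart_trans_map)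
  qed (rule x)
  then have "dtrans \<mu> \<nu> (chart_trans \<kappa> \<mu> ?x) \<circ> dtrans \<kappa> \<mu> ?x = dtrans \<kappa> \<nu> ?x"
    using has_derivative_unique has_derivative_trans x A by blast
  then show ?thesis using assms by (metis chart_trans_map comp_apply)
qed

section \<open>Tangent vectors and their coordinates\<close>

lemma tangent_space_iff:
  "\<xi> \<in> tangent_space A p \<longleftrightarrow>
    (\<forall>\<kappa>\<in>charts_at A p. \<forall>\<mu>\<in>charts_at A p. \<xi> \<mu> = dtrans \<kappa> \<mu> (chart_map \<kappa> p) (\<xi> \<kappa>)) \<and>
    (\<forall>\<kappa>. \<kappa> \<notin> charts_at A p \<longrightarrow> \<xi> \<kappa> = 0)"
  by (simp add: tangent_space_def dtrans_def)

lemma tangent_chart: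
  "\<xi> \<in> tangent_space A p \<Longrightarrow> \<kappa> \<in> charts_at A p \<Longrightarrow> \<mu> \<in> charts_at A p \<Longrightarrow>
    \<xi> \<mu> = dtrans \<kappa> \<mu> (chart_map \<kappa> p) (\<xi> \<kappa>)"
  unfolding tangent_space_iff by blast

lemma tangent_outside: "\<xi> \<in> tangent_space A p \<Longrightarrow> \<kappa> \<notin> charts_at A p \<Longrightarrow> \<xi> \<kappa> = 0"
  unfolding tangent_space_iff by blast

lemma coord_tvec_eq: "coord_tvec A \<kappa> p u \<mu> = (if \<mu> \<in> charts_at A p then dtrans \<kappa> \<mu> (chart_map \<kappa> p) u else 0)"
  by (simp add: coord_tvec_def dtrans_def)

lemma coord_tvec_self [simp]: "\<kappa> \<in> charts_at A p \<Longrightarrow> coord_tvec A \<kappa> p u \<kappa> = u"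
  by (simp add: coord_tvec_eq dtrans_self)

lemma coord_tvec_tangent: "\<kappa> \<in> charts_at A p \<Longrightarrow> coord_tvec A \<kappa> p u \<in> tangent_space A p"
  by (simp add: tangent_space_iff coord_tvec_eq dtrans_trans)

lemma coord_tvec_chart: "\<kappa> \<in> charts_at A p \<Longrightarrow> \<xi> \<in> tangent_space A p \<Longrightarrow> coord_tvec A \<kappa> p (\<xi> \<kappa>) = \<xi>"
  by (rule ext) (simp add: coord_tvec_eq tangent_chart[symmetric] tangent_outside)

lemma tangent_eqI:
  "\<kappa> \<in> charts_at A p \<Longrightarrow> \<xi> \<in> tangent_space A p \<Longrightarrow> \<eta> \<in> tangent_space A p \<Longrightarrow> \<xi> \<kappa> = \<eta> \<kappa> \<Longrightarrow> \<xi> = \<eta>"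
  by (metis coord_tvec_chart)

lemma subspace_tangent_space: "subspace (tangent_space A p)"
proof (rule subspaceI)
  have lin: "linear (dtrans \<kappa> \<mu> (chart_map \<kappa> p))" if "\<kappa> \<in> charts_at A p" "\<mu> \<in> charts_at A p" for \<kappa> \<mu>
    by (rule linear_dtrans[OF that[THEN charts_atD(1)] overlap_mem[OF that]])
  show "0 \<in> tangent_space A p"
    unfolding tangent_space_iff using linear_0[OF lin] by simp
  fix x y :: "('a, 'e) tvec" and a :: real
  assume x: "x \<in> tangent_space A p"
  show "a *\<^sub>R x \<in> tangent_space A p"
    unfolding tangent_space_iff
  proof (intro conjI ballI allI impI)
    fix \<kappa> \<mu> assume \<kappa>\<mu>: "\<kappa> \<in> charts_at A p" "\<mu> \<in> charts_at A p"
    show "(a *\<^sub>R x) \<mu> = dtrans \<kappa> \<mu> (chart_map \<kappa> p) ((a *\<^sub>R x) \<kappa>)"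
      using tangent_chart[OF x \<kappa>\<mu>] linear_scale[OF lin[OF \<kappa>\<mu>]] by (simp add: scaleR_fun_def)
  next
    fix \<kappa> assume "\<kappa> \<notin> charts_at A p"
    then show "(a *\<^sub>R x) \<kappa> = 0" using tangent_outside[OF x] by (simp add: scaleR_fun_def)
  qed
  assume y: "y \<in> tangent_space A p"
  show "x + y \<in> tangent_space A p"
    unfolding tangent_space_iff
  proof (intro conjI ballI allI impI)
    fix \<kappa> \<mu> assume \<kappa>\<mu>: "\<kappa> \<in> charts_at A p" "\<mu> \<in> charts_at A p"
    show "(x + y) \<mu> = dtrans \<kappa> \<mu> (chart_map \<kappa> p) ((x + y) \<kappa>)"
      using tangent_chart[OF x \<kappa>\<mu>] tangent_chart[OF y \<kappa>\<mu>] linear_add[OF lin[OF \<kappa>\<mu>]] by simp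
  next
    fix \<kappa> assume "\<kappa> \<notin> charts_at A p"
    then show "(x + y) \<kappa> = 0" using tangent_outside[OF x] tangent_outside[OF y] by simp
  qed
qed

lemma coord_tvec_add: "\<kappa> \<in> charts_at A p \<Longrightarrow> coord_tvec A \<kappa> p (u + v) = coord_tvec A \<kappa> p u + coord_tvec A \<kappa> p v"
  by (rule tangent_eqI) (auto intro: coord_tvec_tangent subspace_add[OF subspace_tangent_space])

lemma coord_tvec_scaleR: "\<kappa> \<in> charts_at A p \<Longrightarrow> coord_tvec A \<kappa> p (a *\<^sub>R u) = a *\<^sub>R coord_tvec A \<kappa> p u"
  by (rule tangent_eqI[where \<kappa> = \<kappa>, OF _ coord_tvec_tangent subspace_scale[OF subspace_tangent_space coord_tvec_tangent]])
    (simp_all add: scaleR_fun_def)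

end

section \<open>Curves in a manifold with connection\<close>

locale curve = atlas X A for X :: "'a topology" and A :: "('a, 'e::euclidean_space) chart set" +
  fixes \<Gamma> :: "('a, 'e) christoffel" and c :: "real \<Rightarrow> 'a"
  assumes connection: "affine_connection A \<Gamma>" and smooth_curve: "smooth_curve X A c"
begin

section \<open>Times spent in a chart and local representations of the curve\<close>

definition chart_times :: "('a, 'e) chart \<Rightarrow> real set"
  where "chart_times \<kappa> = {t \<in> {0..1}. c t \<in> chart_dom \<kappa>}"

abbreviation local_curve :: "('a, 'e) chart \<Rightarrow> real \<Rightarrow> 'e"
  where "local_curve \<kappa> t \<equiv> chart_map \<kappa> (c t)"

abbreviation local_velocity :: "('a, 'e) chart \<Rightarrow> real \<Rightarrow> 'e"
  where "local_velocity \<kappa> t \<equiv> velocity A c t \<kappa>"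

lemma chart_times_iff: "\<kappa> \<in> A \<Longrightarrow> t \<in> chart_times \<kappa> \<longleftrightarrow> t \<in> {0..1} \<and> \<kappa> \<in> charts_at A (c t)"
  by (auto simp: chart_times_def charts_at_def)

lemma curve_topspace: "t \<in> {0..1} \<Longrightarrow> c t \<in> topspace X"
  using smooth_curve by (auto simp: smooth_curve_def continuous_map_def Pi_iff)

lemma openin_chart_times:
  assumes "\<kappa> \<in> A"
  shows "openin (top_of_set {0..1}) (chart_times \<kappa>)"
  using smooth_curve openin_chart_dom[OF assms] 
  by (auto simp: smooth_curve_def continuous_map_def chart_times_def)

text \<open>Smoothness of curves and fields refers to derivatives within the chart times, but
  \<open>velocity\<close> and \<open>cov_deriv\<close> differentiate within \<open>[0,1]\<close>.
  Chart times are relatively open in \<open>[0,1]\<close>, so both filters coincide.\<close>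

lemma at_within_chart_times:
  assumes "\<kappa> \<in> A" "t \<in> chart_times \<kappa>"
  shows "at t within chart_times \<kappa> = at t within {0..1}"
proof -
  obtain T where T: "open T" "chart_times \<kappa> = T \<inter> {0..1}"
    using openin_chart_times[OF assms(1)] by (auto simp: openin_open)
  then have "t \<in> T" using assms by auto
  then show ?thesis using T by (intro at_within_nhd[where S = T]) auto
qed

lemma at_unit_interval_neq_bot: "t \<in> {0..1} \<Longrightarrow> at t within {0..1::real} \<noteq> bot"
  by (simp add: trivial_limit_within islimpt_Icc)

lemma no_isolated_chart_times: "\<kappa> \<in> A \<Longrightarrow> no_isolated (chart_times \<kappa>)"
  using at_within_chart_times at_unit_interval_neq_bot by (auto simp: no_isolated_def chart_times_def)

lemma vector_derivative_chart_times_iff: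
  assumes "\<kappa> \<in> A" "t \<in> chart_times \<kappa>"
  shows "(f has_vector_derivative d) (at t within chart_times \<kappa>) \<longleftrightarrow> (f has_vector_derivative d) (at t within {0..1})"
  by (simp add: at_within_chart_times[OF assms])

lemma vector_derivative_unit_interval:
  "t \<in> {0..1} \<Longrightarrow> (f has_vector_derivative d) (at t within {0..1}) \<Longrightarrow>
    vector_derivative f (at t within {0..1}) = d"
  using vector_derivative_within at_unit_interval_neq_bot by blast

lemma smooth_local_curve: "\<kappa> \<in> A \<Longrightarrow> smooth_on (chart_times \<kappa>) (local_curve \<kappa>)"
  using smooth_curve by (auto simp: smooth_curve_def chart_times_def o_def)

text \<open>For each order \<open>k\<close> the hypothesis supplies its own derivative function.
  Uniqueness of derivatives within \<open>[0,1]\<close> identifies all of them with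
  \<open>vector_derivative\<close>, which is therefore of every order.\<close>

lemma smooth_on_chart_times_deriv:
  fixes f :: "real \<Rightarrow> 'b::real_normed_vector"
  assumes "\<kappa> \<in> A" "smooth_on (chart_times \<kappa>) f"
  shows "t \<in> chart_times \<kappa> \<Longrightarrow> (f has_vector_derivative vector_derivative f (at t within {0..1})) (at t within {0..1})"
    and "smooth_on (chart_times \<kappa>) (\<lambda>t. vector_derivative f (at t within {0..1}))"
proof -
  have ex: "\<exists>f'. (\<forall>t\<in>chart_times \<kappa>. (f has_vector_derivative f' t) (at t within {0..1})) \<and> Ck_on k (chart_times \<kappa>) f'" for k
  proof -
    have "Ck_on (Suc k) (chart_times \<kappa>) f" using assms(2) unfolding smooth_on_def by blast
    then show ?thesis
      unfolding Ck_on_Suc_iff_deriv[OF no_isolated_chart_times[OF assms(1)]]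
      using vector_derivative_chart_times_iff[OF assms(1)] by blast
  qed
  have in01: "t \<in> {0..1}" if "t \<in> chart_times \<kappa>" for t using that by (auto simp: chart_times_def)
  show "smooth_on (chart_times \<kappa>) (\<lambda>t. vector_derivative f (at t within {0..1}))"
    unfolding smooth_on_def
  proof
    fix k
    from ex obtain f' where f': "\<And>t. t \<in> chart_times \<kappa> \<Longrightarrow> (f has_vector_derivative f' t) (at t within {0..1})"
      and k: "Ck_on k (chart_times \<kappa>) f'" by blast
    show "Ck_on k (chart_times \<kappa>) (\<lambda>t. vector_derivative f (at t within {0..1}))"
      by (rule Ck_on_cong[OF _ k]) (metis f' in01 vector_derivative_unit_interval)
  qed
  show "t \<in> chart_times \<kappa> \<Longrightarrow> (f has_vector_derivative vector_derivative f (at t within {0..1})) (at t within {0..1})"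
    using ex[of 0] in01 vector_derivative_unit_interval by metis
qed

lemma local_velocity_eq: "\<kappa> \<in> A \<Longrightarrow> t \<in> chart_times \<kappa> \<Longrightarrow>
    local_velocity \<kappa> t = vector_derivative (local_curve \<kappa>) (at t within {0..1})"
  by (auto simp: velocity_def chart_times_iff o_def)

lemma has_vector_derivative_local_curve:
  "\<kappa> \<in> A \<Longrightarrow> t \<in> chart_times \<kappa> \<Longrightarrow> (local_curve \<kappa> has_vector_derivative local_velocity \<kappa> t) (at t within {0..1})"
  using smooth_on_chart_times_deriv(1)[OF _ smooth_local_curve] by (simp add: local_velocity_eq)

lemma smooth_local_velocity:
  assumes "\<kappa> \<in> A"
  shows "smooth_on (chart_times \<kappa>) (local_velocity \<kappa>)"
  unfolding smooth_on_def
proof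
  fix k
  have "Ck_on k (chart_times \<kappa>) (\<lambda>t. vector_derivative (local_curve \<kappa>) (at t within {0..1}))"
    using smooth_on_chart_times_deriv(2)[OF assms smooth_local_curve[OF assms]] by (simp add: smooth_on_def)
  then show "Ck_on k (chart_times \<kappa>) (local_velocity \<kappa>)"
    by (rule Ck_on_cong[rotated]) (simp add: local_velocity_eq[OF assms])
qed

lemma bilinear_christoffel: "\<kappa> \<in> charts_at A p \<Longrightarrow> bilinear (\<Gamma> \<kappa> (chart_map \<kappa> p))"
  using connection by (auto simp: affine_connection_def charts_at_def)

text \<open>The connection is smooth for fixed arguments, so both arguments are expanded in the
  basis. The order \<open>k\<close> stays visible instead of full smoothness so that the lemma can
  drive an induction on the regularity of parallel fields.\<close>

lemma Ck_local_christoffel: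
  assumes "\<kappa> \<in> A" "Ck_on k (chart_times \<kappa>) w"
  shows "Ck_on k (chart_times \<kappa>) (\<lambda>t. \<Gamma> \<kappa> (local_curve \<kappa> t) (local_velocity \<kappa> t) (w t))"
proof -
  note S = no_isolated_chart_times[OF assms(1)]
  have x: "Ck_on k (chart_times \<kappa>) (local_curve \<kappa>)" and v: "Ck_on k (chart_times \<kappa>) (local_velocity \<kappa>)"
    using smooth_local_curve smooth_local_velocity assms(1) by (auto simp: smooth_on_def)
  have \<Gamma>: "Ck_on k (chart_range \<kappa>) (\<lambda>x. \<Gamma> \<kappa> x a b)" for a b
    using connection assms(1) by (auto simp: affine_connection_def smooth_on_def)
  have "Ck_on k (chart_times \<kappa>) (\<lambda>t. \<Sum>a\<in>Basis. \<Sum>b\<in>Basis.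
      ((local_velocity \<kappa> t \<bullet> a) * (w t \<bullet> b)) *\<^sub>R \<Gamma> \<kappa> (local_curve \<kappa> t) a b)"
    by (intro Ck_on_sum[OF S] Ck_on_bilinear[OF S bounded_bilinear_scaleR]
        Ck_on_bilinear[OF S bounded_bilinear_mult] Ck_on_bounded_linear[OF S bounded_linear_inner_left]
        v assms(2) Ck_on_compose[OF S open_chart_range[OF assms(1)] _ \<Gamma> x])
      (auto simp: chart_times_def)
  then show ?thesis
    by (rule Ck_on_cong[rotated])
      (use bilinear_eq_sum_Basis[OF bilinear_christoffel] assms(1) in \<open>auto simp: chart_times_iff\<close>)
qed

lemma velocity_chart:
  assumes "t \<in> {0..1}" and \<kappa>: "\<kappa> \<in> charts_at A (c t)" and \<mu>: "\<mu> \<in> charts_at A (c t)"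
  shows "local_velocity \<mu> t = dtrans \<kappa> \<mu> (local_curve \<kappa> t) (local_velocity \<kappa> t)"
proof -
  note A = \<kappa>[THEN charts_atD(1)] \<mu>[THEN charts_atD(1)]
  have t: "t \<in> chart_times \<kappa>" "t \<in> chart_times \<mu>" using assms A by (auto simp: chart_times_iff)
  have "(chart_trans \<kappa> \<mu> \<circ> local_curve \<kappa> has_vector_derivative
      dtrans \<kappa> \<mu> (local_curve \<kappa> t) (local_velocity \<kappa> t)) (at t within {0..1})"
    by (rule vector_derivative_diff_chain_within[OF has_vector_derivative_local_curve[OF A(1) t(1)]
          has_derivative_at_withinI[OF has_derivative_trans[OF A overlap_mem[OF \<kappa> \<mu>]]]])
  \<comment> \<open>The composite agrees with \<open>local_curve \<mu>\<close> only while the curve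
    stays in the domain of \<open>\<kappa>\<close>, so the comparison is made within the chart times
    of \<open>\<kappa>\<close> and then carried back to \<open>[0,1]\<close>.\<close>
  then have *: "(chart_trans \<kappa> \<mu> \<circ> local_curve \<kappa> has_vector_derivative
      dtrans \<kappa> \<mu> (local_curve \<kappa> t) (local_velocity \<kappa> t)) (at t within chart_times \<kappa>)"
    by (simp add: vector_derivative_chart_times_iff[OF A(1) t(1)])
  have "(local_curve \<mu> has_vector_derivative
      dtrans \<kappa> \<mu> (local_curve \<kappa> t) (local_velocity \<kappa> t)) (at t within chart_times \<kappa>)"
    by (rule has_vector_derivative_transform[OF t(1) _ *])
      (use A in \<open>simp add: chart_times_iff chart_trans_map\<close>)
  then have "(local_curve \<mu> has_vector_derivative
      dtrans \<kappa> \<mu> (local_curve \<kappa> t) (local_velocity \<kappa> t)) (at t within {0..1})"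
    by (simp add: vector_derivative_chart_times_iff[OF A(1) t(1)])
  then show ?thesis
    using vector_derivative_unique_within[OF at_unit_interval_neq_bot[OF assms(1)]]
      has_vector_derivative_local_curve[OF A(2) t(2)] by blast
qed

lemma velocity_tangent: "t \<in> {0..1} \<Longrightarrow> velocity A c t \<in> tangent_space A (c t)"
  unfolding tangent_space_iff by (intro conjI ballI allI impI velocity_chart) (simp_all add: velocity_def)

section \<open>Covariant derivatives under change of chart\<close>

lemma at_within_Int_chart_times:
  assumes "\<kappa> \<in> A" "t \<in> chart_times \<kappa>" "J \<subseteq> {0..1}"
  shows "at t within (J \<inter> chart_times \<kappa>) = at t within J"
proof -
  obtain T where T: "open T" "chart_times \<kappa> = T \<inter> {0..1}"
    using openin_chart_times[OF assms(1)] by (auto simp: openin_open)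
  with assms show ?thesis by (intro at_within_nhd[where S = T]) auto
qed

text \<open>Product rule for a moving matrix applied to a moving vector. The second summand is the
  second derivative of the transition map, the term that a Christoffel map has to compensate.
  Derivatives are taken within any \<open>J\<close> in \<open>[0,1]\<close> because parallel fields
  are built on subintervals.\<close>

lemma dtrans_curve_deriv:
  assumes J: "J \<subseteq> {0..1}" "t \<in> J" and \<kappa>: "\<kappa> \<in> charts_at A (c t)" and \<mu>: "\<mu> \<in> charts_at A (c t)"
    and u: "(u has_vector_derivative u') (at t within J)"
  shows "((\<lambda>s. dtrans \<kappa> \<mu> (local_curve \<kappa> s) (u s)) has_vector_derivative
    dtrans \<kappa> \<mu> (local_curve \<kappa> t) u' +
    frechet_derivative (\<lambda>y. dtrans \<kappa> \<mu> y (u t)) (at (local_curve \<kappa> t)) (local_velocity \<kappa> t)) (at t within J)"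
proof -
  let ?x = "local_curve \<kappa>" and ?J = "J \<inter> chart_times \<kappa> \<inter> chart_times \<mu>"
  note A = \<kappa>[THEN charts_atD(1)] \<mu>[THEN charts_atD(1)]
  have t: "t \<in> chart_times \<kappa>" "t \<in> chart_times \<mu>" "t \<in> ?J" using J \<kappa> \<mu> A by (auto simp: chart_times_iff)
  have within: "at t within ?J = at t within J"
    using at_within_Int_chart_times[OF A(1) t(1) J(1)] at_within_Int_chart_times[OF A(2) t(2), of "J \<inter> chart_times \<kappa>"] J(1) by auto
  have x: "?x t \<in> overlap \<kappa> \<mu>" by (rule overlap_mem[OF \<kappa> \<mu>])
  define D where "D b = frechet_derivative (\<lambda>y. dtrans \<kappa> \<mu> y b) (at (?x t))" for b
  have D: "((\<lambda>y. dtrans \<kappa> \<mu> y b) has_derivative D b) (at (?x t))" for b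
    using dtrans_differentiable[OF A x] by (simp add: D_def frechet_derivative_works[symmetric])
  have lin: "dtrans \<kappa> \<mu> y w = (\<Sum>b\<in>Basis. (w \<bullet> b) *\<^sub>R dtrans \<kappa> \<mu> y b)" if "y \<in> overlap \<kappa> \<mu>" for y w
    by (rule linear_eq_sum_Basis[OF linear_dtrans[OF A that]])
  have "((\<lambda>y. \<Sum>b\<in>Basis. (w \<bullet> b) *\<^sub>R dtrans \<kappa> \<mu> y b) has_derivative
      (\<lambda>h. \<Sum>b\<in>Basis. (w \<bullet> b) *\<^sub>R D b h)) (at (?x t))" for w
    by (intro has_derivative_sum has_derivative_scaleR_right D)
  then have "((\<lambda>y. dtrans \<kappa> \<mu> y w) has_derivative (\<lambda>h. \<Sum>b\<in>Basis. (w \<bullet> b) *\<^sub>R D b h)) (at (?x t))" for w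
    by (rule has_derivative_transform_within_open[OF _ open_overlap[OF A] x]) (rule lin[symmetric])
  then have D_sum: "D w = (\<lambda>h. \<Sum>b\<in>Basis. (w \<bullet> b) *\<^sub>R D b h)" for w
    using has_derivative_unique[OF D] by blast
  have dx: "(?x has_vector_derivative local_velocity \<kappa> t) (at t within J)"
    by (rule has_vector_derivative_within_subset[OF has_vector_derivative_local_curve[OF A(1) t(1)] J(1)])
  have "((\<lambda>y. dtrans \<kappa> \<mu> y b) \<circ> ?x has_vector_derivative D b (local_velocity \<kappa> t)) (at t within J)" for b
    by (rule vector_derivative_diff_chain_within[OF dx has_derivative_at_withinI[OF D]])
  then have db: "((\<lambda>s. dtrans \<kappa> \<mu> (?x s) b) has_vector_derivative D b (local_velocity \<kappa> t)) (at t within J)" for b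
    by (simp add: o_def)
  have "((\<lambda>s. u s \<bullet> b) has_field_derivative u' \<bullet> b) (at t within J)" for b
    unfolding has_real_derivative_iff_has_vector_derivative
    by (rule bounded_linear.has_vector_derivative[OF bounded_linear_inner_left u])
  then have "((\<lambda>s. \<Sum>b\<in>Basis. (u s \<bullet> b) *\<^sub>R dtrans \<kappa> \<mu> (?x s) b) has_vector_derivative
      (\<Sum>b\<in>Basis. (u t \<bullet> b) *\<^sub>R D b (local_velocity \<kappa> t) + (u' \<bullet> b) *\<^sub>R dtrans \<kappa> \<mu> (?x t) b)) (at t within J)"
    by (intro has_vector_derivative_sum has_vector_derivative_scaleR db)
  also have "(\<Sum>b\<in>Basis. (u t \<bullet> b) *\<^sub>R D b (local_velocity \<kappa> t) + (u' \<bullet> b) *\<^sub>R dtrans \<kappa> \<mu> (?x t) b) =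
      dtrans \<kappa> \<mu> (?x t) u' + D (u t) (local_velocity \<kappa> t)"
    by (simp add: sum.distrib lin[OF x, of u'] D_sum[of "u t"])
  finally have *: "((\<lambda>s. \<Sum>b\<in>Basis. (u s \<bullet> b) *\<^sub>R dtrans \<kappa> \<mu> (?x s) b) has_vector_derivative
      dtrans \<kappa> \<mu> (?x t) u' + D (u t) (local_velocity \<kappa> t)) (at t within ?J)"
    by (simp only: within)
  have "((\<lambda>s. dtrans \<kappa> \<mu> (?x s) (u s)) has_vector_derivative
      dtrans \<kappa> \<mu> (?x t) u' + D (u t) (local_velocity \<kappa> t)) (at t within ?J)"
  proof (rule has_vector_derivative_transform[OF t(3) _ *])
    fix s assume "s \<in> ?J"
    then have "?x s \<in> overlap \<kappa> \<mu>" using A by (auto simp: chart_times_iff intro: overlap_mem)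
    then show "dtrans \<kappa> \<mu> (?x s) (u s) = (\<Sum>b\<in>Basis. (u s \<bullet> b) *\<^sub>R dtrans \<kappa> \<mu> (?x s) b)"
      by (rule lin)
  qed
  then show ?thesis by (simp only: within D_def)
qed

text \<open>A relational counterpart of \<open>cov_deriv\<close>: it asserts differentiability,
  which the total function \<open>vector_derivative\<close> cannot do, works within an arbitrary set
  \<open>J\<close>, and speaks of a single chart, so that change of chart becomes a theorem.\<close>

definition has_cov_deriv ::
  "real set \<Rightarrow> ('a, 'e) chart \<Rightarrow> (real \<Rightarrow> ('a, 'e) tvec) \<Rightarrow> real \<Rightarrow> ('a, 'e) tvec \<Rightarrow> bool"
  where "has_cov_deriv J \<kappa> h t \<xi> \<longleftrightarrow> ((\<lambda>s. h s \<kappa>) has_vector_derivative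
    \<xi> \<kappa> - \<Gamma> \<kappa> (local_curve \<kappa> t) (local_velocity \<kappa> t) (h t \<kappa>)) (at t within J)"

text \<open>The second derivative of the transition map that appears in the derivative of \<open>h\<close> in the new
  chart is absorbed by the transformation rule of the Christoffel maps.\<close>

lemma has_cov_deriv_chart:
  assumes J: "J \<subseteq> {0..1}" "t \<in> J" and \<kappa>: "\<kappa> \<in> charts_at A (c t)" and \<mu>: "\<mu> \<in> charts_at A (c t)"
    and h: "\<And>s. s \<in> J \<Longrightarrow> h s \<in> tangent_space A (c s)" and \<xi>: "\<xi> \<in> tangent_space A (c t)"
    and deriv: "has_cov_deriv J \<kappa> h t \<xi>"
  shows "has_cov_deriv J \<mu> h t \<xi>"
proof -
  let ?x = "local_curve \<kappa>" and ?J = "J \<inter> chart_times \<kappa> \<inter> chart_times \<mu>" and ?v = "local_velocity \<kappa> t"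
  note A = \<kappa>[THEN charts_atD(1)] \<mu>[THEN charts_atD(1)]
  have t: "t \<in> chart_times \<kappa>" "t \<in> chart_times \<mu>" "t \<in> ?J" using J \<kappa> \<mu> A by (auto simp: chart_times_iff)
  have t01: "t \<in> {0..1}" using J by auto
  have within: "at t within ?J = at t within J"
    using at_within_Int_chart_times[OF A(1) t(1) J(1)] at_within_Int_chart_times[OF A(2) t(2), of "J \<inter> chart_times \<kappa>"] J(1) by auto
  have x: "?x t \<in> overlap \<kappa> \<mu>" by (rule overlap_mem[OF \<kappa> \<mu>])
  define D where "D = frechet_derivative (\<lambda>y. dtrans \<kappa> \<mu> y (h t \<kappa>)) (at (?x t)) ?v"
  have "((\<lambda>s. dtrans \<kappa> \<mu> (?x s) (h s \<kappa>)) has_vector_derivative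
      dtrans \<kappa> \<mu> (?x t) (\<xi> \<kappa> - \<Gamma> \<kappa> (?x t) ?v (h t \<kappa>)) + D) (at t within J)"
    unfolding D_def by (rule dtrans_curve_deriv[OF J \<kappa> \<mu> deriv[unfolded has_cov_deriv_def]])
  then have *: "((\<lambda>s. dtrans \<kappa> \<mu> (?x s) (h s \<kappa>)) has_vector_derivative
      dtrans \<kappa> \<mu> (?x t) (\<xi> \<kappa> - \<Gamma> \<kappa> (?x t) ?v (h t \<kappa>)) + D) (at t within ?J)"
    by (simp only: within)
  have "((\<lambda>s. h s \<mu>) has_vector_derivative
      dtrans \<kappa> \<mu> (?x t) (\<xi> \<kappa> - \<Gamma> \<kappa> (?x t) ?v (h t \<kappa>)) + D) (at t within ?J)"
    by (rule has_vector_derivative_transform[OF t(3) _ *])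
      (use A h in \<open>auto simp: chart_times_iff intro!: tangent_chart\<close>)
  moreover have "dtrans \<kappa> \<mu> (?x t) (\<Gamma> \<kappa> (?x t) ?v (h t \<kappa>)) = D +
      \<Gamma> \<mu> (chart_trans \<kappa> \<mu> (?x t)) (dtrans \<kappa> \<mu> (?x t) ?v) (dtrans \<kappa> \<mu> (?x t) (h t \<kappa>))"
    using connection A x unfolding affine_connection_def Let_def D_def dtrans_def overlap_def by blast
  then have "dtrans \<kappa> \<mu> (?x t) (\<Gamma> \<kappa> (?x t) ?v (h t \<kappa>)) =
      D + \<Gamma> \<mu> (local_curve \<mu> t) (local_velocity \<mu> t) (h t \<mu>)"
    by (simp add: chart_trans_map[OF \<kappa>] velocity_chart[OF t01 \<kappa> \<mu>] tangent_chart[OF h[OF J(2)] \<kappa> \<mu>])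
  then have "dtrans \<kappa> \<mu> (?x t) (\<xi> \<kappa> - \<Gamma> \<kappa> (?x t) ?v (h t \<kappa>)) + D =
      \<xi> \<mu> - \<Gamma> \<mu> (local_curve \<mu> t) (local_velocity \<mu> t) (h t \<mu>)"
    by (simp add: linear_diff[OF linear_dtrans[OF A x]] tangent_chart[OF \<xi> \<kappa> \<mu>])
  ultimately show ?thesis unfolding has_cov_deriv_def within by simp
qed

section \<open>Vector fields along a curve\<close>

lemma tangent_ImmD:
  assumes "h \<in> tangent_Imm A c"
  shows "t \<in> {0..1} \<Longrightarrow> h t \<in> tangent_space A (c t)" "t \<notin> {0..1} \<Longrightarrow> h t = 0"
    "\<kappa> \<in> A \<Longrightarrow> smooth_on (chart_times \<kappa>) (\<lambda>t. h t \<kappa>)"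
  using assms by (auto simp: tangent_Imm_def chart_times_def)

lemma cov_deriv_eq: "\<kappa> \<in> charts_at A (c t) \<Longrightarrow> cov_deriv A \<Gamma> c h t \<kappa> =
    vector_derivative (\<lambda>s. h s \<kappa>) (at t within {0..1}) +
    \<Gamma> \<kappa> (local_curve \<kappa> t) (local_velocity \<kappa> t) (h t \<kappa>)"
  by (simp add: cov_deriv_def)

lemma has_cov_deriv_cov_deriv:
  assumes "h \<in> tangent_Imm A c" "t \<in> {0..1}" "\<kappa> \<in> charts_at A (c t)"
  shows "has_cov_deriv {0..1} \<kappa> h t (cov_deriv A \<Gamma> c h t)"
  unfolding has_cov_deriv_def
  using assms smooth_on_chart_times_deriv(1)[OF charts_atD(1)[OF assms(3)]
      tangent_ImmD(3)[OF assms(1) charts_atD(1)[OF assms(3)]], of t] charts_atD(1)[OF assms(3)]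
  by (simp add: cov_deriv_eq chart_times_iff)

lemma cov_deriv_unique:
  assumes "t \<in> {0..1}" "\<kappa> \<in> charts_at A (c t)" "has_cov_deriv {0..1} \<kappa> h t \<xi>"
  shows "cov_deriv A \<Gamma> c h t \<kappa> = \<xi> \<kappa>"
  using vector_derivative_unit_interval[OF assms(1) assms(3)[unfolded has_cov_deriv_def]] assms(2)
  by (simp add: cov_deriv_eq)

lemma cov_deriv_tangent:
  assumes h: "h \<in> tangent_Imm A c" and t: "t \<in> {0..1}"
  shows "cov_deriv A \<Gamma> c h t \<in> tangent_space A (c t)"
proof -
  obtain \<kappa> where \<kappa>: "\<kappa> \<in> charts_at A (c t)" using charts_at_nonempty curve_topspace[OF t] by blast
  \<comment> \<open>The value in one chart is spread out to a genuine tangent vector. Change of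
    chart makes it the covariant derivative in every chart at \<open>c t\<close>, and uniqueness
    identifies it with \<open>cov_deriv\<close>.\<close>
  define \<xi> where "\<xi> = coord_tvec A \<kappa> (c t) (cov_deriv A \<Gamma> c h t \<kappa>)"
  have \<xi>: "\<xi> \<in> tangent_space A (c t)" by (simp add: \<xi>_def coord_tvec_tangent \<kappa>)
  have "has_cov_deriv {0..1} \<kappa> h t \<xi>"
    using has_cov_deriv_cov_deriv[OF h t \<kappa>] by (simp add: has_cov_deriv_def \<xi>_def \<kappa>)
  then have "has_cov_deriv {0..1} \<mu> h t \<xi>" if "\<mu> \<in> charts_at A (c t)" for \<mu>
    using has_cov_deriv_chart[OF _ t \<kappa> that tangent_ImmD(1)[OF h] \<xi>] by auto
  then have "cov_deriv A \<Gamma> c h t \<mu> = \<xi> \<mu>" for \<mu>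
    using cov_deriv_unique[OF t] tangent_outside[OF \<xi>] by (cases "\<mu> \<in> charts_at A (c t)") (auto simp: cov_deriv_def)
  then have "cov_deriv A \<Gamma> c h t = \<xi>" by blast
  with \<xi> show ?thesis by simp
qed

lemma Ck_on_cov_deriv:
  assumes h: "h \<in> tangent_Imm A c" and \<kappa>: "\<kappa> \<in> A"
  shows "Ck_on k (chart_times \<kappa>) (\<lambda>t. cov_deriv A \<Gamma> c h t \<kappa>)"
proof -
  note sm = tangent_ImmD(3)[OF h \<kappa>]
  have "Ck_on k (chart_times \<kappa>) (\<lambda>t. vector_derivative (\<lambda>s. h s \<kappa>) (at t within {0..1}) +
      \<Gamma> \<kappa> (local_curve \<kappa> t) (local_velocity \<kappa> t) (h t \<kappa>))"
    using smooth_on_chart_times_deriv(2)[OF \<kappa> sm] sm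
    by (intro Ck_on_add no_isolated_chart_times Ck_local_christoffel \<kappa>) (auto simp: smooth_on_def)
  then show ?thesis
    by (rule Ck_on_cong[rotated]) (use \<kappa> in \<open>simp add: chart_times_iff cov_deriv_eq\<close>)
qed

lemma subspace_tangent_Imm: "subspace (tangent_Imm A c)"
proof (rule subspaceI)
  note T = subspace_tangent_space and S = no_isolated_chart_times
  have mem: "h \<in> tangent_Imm A c" if "\<And>t. t \<in> {0..1} \<Longrightarrow> h t \<in> tangent_space A (c t)" "\<And>t. t \<notin> {0..1} \<Longrightarrow> h t = 0"
    "\<And>\<kappa> k. \<kappa> \<in> A \<Longrightarrow> Ck_on k (chart_times \<kappa>) (\<lambda>t. h t \<kappa>)" for h
    using that unfolding tangent_Imm_def smooth_on_def chart_times_def by blast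
  show "0 \<in> tangent_Imm A c"
    by (rule mem) (auto simp: subspace_0[OF T] Ck_on_const[OF S])
  fix h k and a :: real assume h: "h \<in> tangent_Imm A c"
  show "a *\<^sub>R h \<in> tangent_Imm A c"
  proof (rule mem)
    fix \<kappa> and n assume \<kappa>: "\<kappa> \<in> A"
    have "Ck_on n (chart_times \<kappa>) (\<lambda>t. a *\<^sub>R h t \<kappa>)"
      using tangent_ImmD(3)[OF h \<kappa>]
      by (intro Ck_on_bounded_linear[OF S[OF \<kappa>] bounded_linear_scaleR_right]) (simp add: smooth_on_def)
    then show "Ck_on n (chart_times \<kappa>) (\<lambda>t. (a *\<^sub>R h) t \<kappa>)" by (simp add: scaleR_fun_def)
  next
    fix t :: real assume "t \<in> {0..1}"
    then have "a *\<^sub>R h t \<in> tangent_space A (c t)" using subspace_scale[OF T] tangent_ImmD(1)[OF h] by blast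
    then show "(a *\<^sub>R h) t \<in> tangent_space A (c t)" by (simp add: scaleR_fun_def)
  qed (use tangent_ImmD(2)[OF h] in \<open>auto simp: scaleR_fun_def\<close>)
  assume k: "k \<in> tangent_Imm A c"
  show "h + k \<in> tangent_Imm A c"
  proof (rule mem)
    fix \<kappa> and n assume \<kappa>: "\<kappa> \<in> A"
    show "Ck_on n (chart_times \<kappa>) (\<lambda>t. (h + k) t \<kappa>)"
      using tangent_ImmD(3)[OF h \<kappa>] tangent_ImmD(3)[OF k \<kappa>]
      by (simp add: smooth_on_def Ck_on_add[OF S[OF \<kappa>]])
  next
    fix t :: real assume "t \<in> {0..1}"
    then show "(h + k) t \<in> tangent_space A (c t)"
      using subspace_add[OF T] tangent_ImmD(1)[OF h] tangent_ImmD(1)[OF k] by simp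
  qed (use tangent_ImmD(2)[OF h] tangent_ImmD(2)[OF k] in auto)
qed

section \<open>Linearity of the covariant derivative\<close>

lemma linear_christoffel: "\<kappa> \<in> charts_at A p \<Longrightarrow> linear (\<Gamma> \<kappa> (chart_map \<kappa> p) v)"
  using bilinear_christoffel by (auto simp: bilinear_def)

lemma cov_deriv_add:
  assumes "h \<in> tangent_Imm A c" "k \<in> tangent_Imm A c" "t \<in> {0..1}"
  shows "cov_deriv A \<Gamma> c (h + k) t = cov_deriv A \<Gamma> c h t + cov_deriv A \<Gamma> c k t"
proof
  fix \<kappa>
  show "cov_deriv A \<Gamma> c (h + k) t \<kappa> = (cov_deriv A \<Gamma> c h t + cov_deriv A \<Gamma> c k t) \<kappa>"
  proof (cases "\<kappa> \<in> charts_at A (c t)")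
    case True
    note has_vector_derivative_add[OF has_cov_deriv_cov_deriv[OF assms(1,3) True, unfolded has_cov_deriv_def]
        has_cov_deriv_cov_deriv[OF assms(2,3) True, unfolded has_cov_deriv_def]]
    then have "has_cov_deriv {0..1} \<kappa> (h + k) t (cov_deriv A \<Gamma> c h t + cov_deriv A \<Gamma> c k t)"
      by (simp add: has_cov_deriv_def linear_add[OF linear_christoffel[OF True]] algebra_simps)
    then show ?thesis by (rule cov_deriv_unique[OF assms(3) True])
  qed (simp add: cov_deriv_def)
qed

lemma cov_deriv_scaleR:
  assumes "h \<in> tangent_Imm A c" "t \<in> {0..1}"
  shows "cov_deriv A \<Gamma> c (a *\<^sub>R h) t = a *\<^sub>R cov_deriv A \<Gamma> c h t"
proof
  fix \<kappa>
  show "cov_deriv A \<Gamma> c (a *\<^sub>R h) t \<kappa> = (a *\<^sub>R cov_deriv A \<Gamma> c h t) \<kappa>"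
  proof (cases "\<kappa> \<in> charts_at A (c t)")
    case True
    note bounded_linear.has_vector_derivative[OF bounded_linear_scaleR_right[of a]
        has_cov_deriv_cov_deriv[OF assms True, unfolded has_cov_deriv_def]]
    then have "has_cov_deriv {0..1} \<kappa> (a *\<^sub>R h) t (a *\<^sub>R cov_deriv A \<Gamma> c h t)"
      by (simp add: has_cov_deriv_def scaleR_fun_def linear_scale[OF linear_christoffel[OF True]] algebra_simps)
    then show ?thesis by (rule cov_deriv_unique[OF assms(2) True])
  qed (simp add: cov_deriv_def scaleR_fun_def)
qed

lemma subspace_parallel_fields: "subspace (parallel_fields A \<Gamma> c)"
proof (rule subspaceI)
  note T = subspace_tangent_Imm
  show "0 \<in> parallel_fields A \<Gamma> c"
    using cov_deriv_scaleR[OF subspace_0[OF T], of _ 0] subspace_0[OF T] by (simp add: parallel_fields_def)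
  show "x + y \<in> parallel_fields A \<Gamma> c" if "x \<in> parallel_fields A \<Gamma> c" "y \<in> parallel_fields A \<Gamma> c" for x y
    using that cov_deriv_add subspace_add[OF T] by (simp add: parallel_fields_def)
  show "a *\<^sub>R x \<in> parallel_fields A \<Gamma> c" if "x \<in> parallel_fields A \<Gamma> c" for a x
    using that cov_deriv_scaleR subspace_scale[OF T] by (simp add: parallel_fields_def)
qed

end

section \<open>Parallel transport\<close>

text \<open>Meant for the junction of two adjacent intervals, where a left and a right derivative
  with the same value combine.\<close>

lemma has_vector_derivative_within_Un:
  assumes "(f has_vector_derivative d) (at x within S)" "(f has_vector_derivative d) (at x within T)"
  shows "(f has_vector_derivative d) (at x within (S \<union> T))"
  using assms unfolding has_vector_derivative_def has_derivative_within by (auto intro: Lim_Un)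

context curve
begin

text \<open>The parallel equation on a piece of \<open>[0,1]\<close>. All charts at
  \<open>c t\<close> are included since neighbouring pieces may be solved in different charts.
  Smoothness is left out because it follows from the equation.\<close>

definition parallel_on :: "real set \<Rightarrow> (real \<Rightarrow> ('a, 'e) tvec) \<Rightarrow> bool"
  where "parallel_on J h \<longleftrightarrow> (\<forall>t\<in>J. h t \<in> tangent_space A (c t) \<and>
    (\<forall>\<kappa>\<in>charts_at A (c t). has_cov_deriv J \<kappa> h t 0))"

lemma has_cov_deriv_0: "has_cov_deriv J \<kappa> h t 0 \<longleftrightarrow> ((\<lambda>s. h s \<kappa>) has_vector_derivative
    - \<Gamma> \<kappa> (local_curve \<kappa> t) (local_velocity \<kappa> t) (h t \<kappa>)) (at t within J)"
  by (simp add: has_cov_deriv_def)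

lemma parallel_on_subset: "parallel_on J h \<Longrightarrow> I \<subseteq> J \<Longrightarrow> parallel_on I h"
  unfolding parallel_on_def has_cov_deriv_def
  by (blast intro: has_vector_derivative_within_subset)

text \<open>For a first-order equation matching values suffice: at \<open>b\<close> both one-sided
  derivatives are prescribed by the common value \<open>h b = k b\<close>. Away from
  \<open>b\<close> only one piece is seen locally.\<close>

lemma parallel_on_glue:
  assumes h: "parallel_on {a..b} h" and k: "parallel_on {b..e} k" and "h b = k b" and "a \<le> b" "b \<le> e"
  shows "parallel_on {a..e} (\<lambda>t. if t \<le> b then h t else k t)"
  unfolding parallel_on_def
proof (intro ballI conjI)
  let ?f = "\<lambda>t. if t \<le> b then h t else k t"
  fix t assume t: "t \<in> {a..e}"
  show "?f t \<in> tangent_space A (c t)"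
    using h k t by (auto simp: parallel_on_def)
  fix \<kappa> assume \<kappa>: "\<kappa> \<in> charts_at A (c t)"
  have left: "has_cov_deriv {a..b} \<kappa> ?f t 0" if "t \<le> b"
  proof -
    have ht: "((\<lambda>s. h s \<kappa>) has_vector_derivative
        - \<Gamma> \<kappa> (local_curve \<kappa> t) (local_velocity \<kappa> t) (h t \<kappa>)) (at t within {a..b})"
      using h \<kappa> t that by (auto simp: parallel_on_def has_cov_deriv_0)
    show ?thesis
      unfolding has_cov_deriv_0
      using has_vector_derivative_transform[OF _ _ ht, of "\<lambda>s. ?f s \<kappa>"] t that by simp
  qed
  have right: "has_cov_deriv {b..e} \<kappa> ?f t 0" if "b \<le> t"
  proof -
    have kt: "((\<lambda>s. k s \<kappa>) has_vector_derivative
        - \<Gamma> \<kappa> (local_curve \<kappa> t) (local_velocity \<kappa> t) (k t \<kappa>)) (at t within {b..e})"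
      using k \<kappa> t that by (auto simp: parallel_on_def has_cov_deriv_0)
    \<comment> \<open>At \<open>s = b\<close> the glued field takes its value from \<open>h\<close>;
      the matching condition makes it agree with \<open>k\<close> on the closed right interval,
      endpoint included.\<close>
    have eq: "?f s = k s" if "b \<le> s" for s using that \<open>h b = k b\<close> by (cases "s = b") auto
    show ?thesis
      unfolding has_cov_deriv_0
      using has_vector_derivative_transform[OF _ _ kt, of "\<lambda>s. ?f s \<kappa>"] t that eq by simp
  qed
  consider "t < b" | "t = b" | "b < t" by linarith
  then show "has_cov_deriv {a..e} \<kappa> ?f t 0"
  proof cases
    case 1
    then have "at t within {a..e} = at t within {a..b}"
      using assms(5) by (intro at_within_nhd[where S = "{..<b}"]) auto
    then show ?thesis using left 1 unfolding has_cov_deriv_def by simp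
  next
    case 2
    have "{a..e} = {a..b} \<union> {b..e}" using assms(4,5) by auto
    then show ?thesis using left right 2 unfolding has_cov_deriv_def
      by (simp only: has_vector_derivative_within_Un order_refl)
  next
    case 3
    then have "at t within {a..e} = at t within {b..e}"
      using assms(4) by (intro at_within_nhd[where S = "{b<..}"]) auto
    then show ?thesis using right 3 unfolding has_cov_deriv_def by simp
  qed
qed

text \<open>Supplies around each time one chart together with a uniform bound on the coefficient of
  the parallel equation, hence an interval length on which the contraction argument works for every
  initial vector.\<close>

lemma local_christoffel_bound:
  assumes "t0 \<in> {0..1}"
  obtains \<kappa> d L where "\<kappa> \<in> A" "0 < d" "0 \<le> L"
    "\<And>t. t \<in> {0..1} \<Longrightarrow> \<bar>t - t0\<bar> < d \<Longrightarrow> t \<in> chart_times \<kappa>"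
    "\<And>t w. t \<in> {0..1} \<Longrightarrow> \<bar>t - t0\<bar> < d \<Longrightarrow>
      norm (\<Gamma> \<kappa> (local_curve \<kappa> t) (local_velocity \<kappa> t) w) \<le> L * norm w"
proof -
  obtain \<kappa> where \<kappa>: "\<kappa> \<in> charts_at A (c t0)" using charts_at_nonempty curve_topspace[OF assms] by blast
  then have A: "\<kappa> \<in> A" and t0: "t0 \<in> chart_times \<kappa>" using assms charts_atD chart_times_iff by blast+
  let ?B = "\<lambda>t. \<Gamma> \<kappa> (local_curve \<kappa> t) (local_velocity \<kappa> t)"
  \<comment> \<open>The sum of the norms of the images of the basis vectors dominates the operator
    norm and, unlike it, is visibly continuous. Within distance \<open>d1\<close> it exceeds
    \<open>f t0\<close> by less than 1, whence the constant \<open>f t0 + 1\<close>.\<close>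
  define f where "f t = (\<Sum>b\<in>Basis. norm (?B t b))" for t
  have "continuous_on (chart_times \<kappa>) (\<lambda>t. ?B t b)" for b
    using Ck_local_christoffel[OF A Ck_on_const[OF no_isolated_chart_times[OF A]], of 0 b] by simp
  then have "continuous_on (chart_times \<kappa>) f"
    unfolding f_def by (intro continuous_intros)
  then obtain d1 where d1: "d1 > 0" "\<And>t. t \<in> chart_times \<kappa> \<Longrightarrow> dist t t0 < d1 \<Longrightarrow> dist (f t) (f t0) < 1"
    using t0 unfolding continuous_on_iff by (metis zero_less_one)
  obtain T where T: "open T" "chart_times \<kappa> = T \<inter> {0..1}"
    using openin_chart_times[OF A] by (auto simp: openin_open)
  then obtain d2 where d2: "d2 > 0" "\<And>t. dist t t0 < d2 \<Longrightarrow> t \<in> T"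
    using t0 unfolding open_dist by blast
  show ?thesis
  proof (rule that[OF A])
    show "0 < min d1 d2" using d1 d2 by simp
    show "0 \<le> f t0 + 1" unfolding f_def by (simp add: sum_nonneg)
    fix t assume t: "t \<in> {0..1}" "\<bar>t - t0\<bar> < min d1 d2"
    then show tt: "t \<in> chart_times \<kappa>" using T d2 by (simp add: dist_real_def)
    have f: "f t \<le> f t0 + 1" using d1(2)[OF tt] t(2) by (simp add: dist_real_def)
    fix w
    have "\<kappa> \<in> charts_at A (c t)" using tt A by (simp add: chart_times_iff)
    then have "?B t w = (\<Sum>b\<in>Basis. (w \<bullet> b) *\<^sub>R ?B t b)"
      by (rule linear_eq_sum_Basis[OF linear_christoffel])
    also have "norm \<dots> \<le> (\<Sum>b\<in>Basis. norm ((w \<bullet> b) *\<^sub>R ?B t b))" by (rule norm_sum)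
    also have "\<dots> \<le> (\<Sum>b\<in>Basis. norm w * norm (?B t b))"
      by (intro sum_mono) (simp add: Basis_le_norm mult_right_mono)
    also have "\<dots> = f t * norm w" by (simp add: f_def sum_distrib_left[symmetric])
    also have "\<dots> \<le> (f t0 + 1) * norm w" using f by (intro mult_right_mono) auto
    finally show "norm (?B t w) \<le> (f t0 + 1) * norm w" .
  qed
qed

text \<open>The equation is solved for the coordinates in \<open>\<kappa>\<close> and the solution
  is lifted by \<open>coord_tvec\<close>. The lifted field satisfies the equation in every other
  chart because vanishing of the covariant derivative is independent of the chart.\<close>

lemma local_parallel_on_exists:
  assumes "a \<le> b" and J: "{a..b} \<subseteq> chart_times \<kappa>" and A: "\<kappa> \<in> A"
    and bound: "\<And>t w. t \<in> {a..b} \<Longrightarrow> norm (\<Gamma> \<kappa> (local_curve \<kappa> t) (local_velocity \<kappa> t) w) \<le> L * norm w"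
    and short: "0 \<le> L" "L * (b - a) < 1" and \<eta>: "\<eta> \<in> tangent_space A (c a)"
  shows "\<exists>h. parallel_on {a..b} h \<and> h a = \<eta>"
proof -
  let ?B = "\<lambda>t w. - \<Gamma> \<kappa> (local_curve \<kappa> t) (local_velocity \<kappa> t) w"
  have \<kappa>: "\<kappa> \<in> charts_at A (c t)" "t \<in> {0..1}" if "t \<in> {a..b}" for t
    using that J A chart_times_iff by blast+
  have "\<exists>u. u a = \<eta> \<kappa> \<and> (\<forall>t\<in>{a..b}. (u has_vector_derivative ?B t (u t)) (at t within {a..b}))"
  proof (rule linear_ode_exists[OF \<open>a \<le> b\<close> _ _ _ short])
    show "linear (?B t)" if "t \<in> {a..b}" for t
      using linear_compose_neg[OF linear_christoffel[OF \<kappa>(1)[OF that]]] .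
    show "continuous_on {a..b} (\<lambda>t. ?B t w)" for w
      using Ck_local_christoffel[OF A Ck_on_const[OF no_isolated_chart_times[OF A]], of 0 w]
      by (intro continuous_intros) (auto intro: continuous_on_subset[OF _ J])
    show "norm (?B t w) \<le> L * norm w" if "t \<in> {a..b}" for t w
      using bound[OF that] by simp
  qed
  then obtain u where u: "u a = \<eta> \<kappa>"
    "\<And>t. t \<in> {a..b} \<Longrightarrow> (u has_vector_derivative ?B t (u t)) (at t within {a..b})" by blast
  define h where "h t = coord_tvec A \<kappa> (c t) (u t)" for t
  have h: "h t \<in> tangent_space A (c t)" "h t \<kappa> = u t" if "t \<in> {a..b}" for t
    using \<kappa>[OF that] by (simp_all add: h_def coord_tvec_tangent)
  have "parallel_on {a..b} h"
    unfolding parallel_on_def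
  proof (intro ballI conjI)
    fix t assume t: "t \<in> {a..b}"
    then show "h t \<in> tangent_space A (c t)" by (rule h)
    fix \<mu> assume \<mu>: "\<mu> \<in> charts_at A (c t)"
    have "((\<lambda>s. h s \<kappa>) has_vector_derivative ?B t (u t)) (at t within {a..b})"
      by (rule has_vector_derivative_transform[OF t _ u(2)[OF t]]) (simp add: h)
    then have "has_cov_deriv {a..b} \<kappa> h t 0" by (simp add: has_cov_deriv_0 h(2)[OF t])
    then show "has_cov_deriv {a..b} \<mu> h t 0"
      using \<kappa> h(1) t by (intro has_cov_deriv_chart[OF _ t \<kappa>(1)[OF t] \<mu>] subspace_0[OF subspace_tangent_space]) auto
  qed
  moreover have "h a = \<eta>" using \<kappa>(1)[of a] \<open>a \<le> b\<close> by (simp add: h_def u(1) coord_tvec_chart \<eta>)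
  ultimately show ?thesis by blast
qed

lemma local_parallel_on_unique:
  assumes J: "{a..b} \<subseteq> chart_times \<kappa>" and A: "\<kappa> \<in> A"
    and bound: "\<And>t w. t \<in> {a..b} \<Longrightarrow> norm (\<Gamma> \<kappa> (local_curve \<kappa> t) (local_velocity \<kappa> t) w) \<le> L * norm w"
    and h: "parallel_on {a..b} h" "h a = 0" and t: "t \<in> {a..b}"
  shows "h t = 0"
proof -
  have \<kappa>: "\<kappa> \<in> charts_at A (c s)" if "s \<in> {a..b}" for s
    using that J A chart_times_iff by blast
  have "h t \<kappa> = 0"
  proof (rule linear_ode_unique[OF _ _ _ t])
    show "((\<lambda>s. h s \<kappa>) has_vector_derivative - \<Gamma> \<kappa> (local_curve \<kappa> s) (local_velocity \<kappa> s) (h s \<kappa>))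
        (at s within {a..b})" if "s \<in> {a..b}" for s
      using h(1) \<kappa>[OF that] that by (simp add: parallel_on_def has_cov_deriv_0)
    show "norm (- \<Gamma> \<kappa> (local_curve \<kappa> s) (local_velocity \<kappa> s) w) \<le> L * norm w" if "s \<in> {a..b}" for s w
      using bound[OF that] by simp
    show "h a \<kappa> = 0" using h(2) by simp
  qed
  then show ?thesis
    using h(1) t \<kappa>[OF t] subspace_0[OF subspace_tangent_space]
    by (intro tangent_eqI[where \<kappa> = \<kappa>]) (auto simp: parallel_on_def)
qed

text \<open>The bisection principle \<open>Bolzano\<close> replaces a choice of finitely many
  charts: solvability passes from two adjacent intervals to their union and holds on all short
  intervals around each point, hence on \<open>[0,1]\<close>.\<close>

lemma parallel_on_exists:
  assumes \<eta>: "\<eta> \<in> tangent_space A (c 0)"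
  shows "\<exists>h. parallel_on {0..1} h \<and> h 0 = \<eta>"
proof -
  define P where "P a b \<longleftrightarrow> ({a..b} \<subseteq> {0..1} \<longrightarrow>
    (\<forall>\<eta>\<in>tangent_space A (c a). \<exists>h. parallel_on {a..b} h \<and> h a = \<eta>))" for a b :: real
  have "P 0 1"
  proof (rule Bolzano[of 0 1 P])
    fix a b e :: real assume "P a b" "P b e" and le: "a \<le> b" "b \<le> e"
    show "P a e"
      unfolding P_def
    proof (intro impI ballI)
      fix \<eta> assume sub: "{a..e} \<subseteq> {0..1}" and \<eta>: "\<eta> \<in> tangent_space A (c a)"
      have "{a..b} \<subseteq> {0..1}" "{b..e} \<subseteq> {0..1}" using sub le by auto
      then obtain h where h: "parallel_on {a..b} h" "h a = \<eta>"
        using \<open>P a b\<close> \<eta> unfolding P_def by blast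
      have "h b \<in> tangent_space A (c b)" using h(1) le by (simp add: parallel_on_def)
      then obtain k where k: "parallel_on {b..e} k" "k b = h b"
        using \<open>P b e\<close> \<open>{b..e} \<subseteq> {0..1}\<close> unfolding P_def by blast
      show "\<exists>h. parallel_on {a..e} h \<and> h a = \<eta>"
        using parallel_on_glue[OF h(1) k(1) k(2)[symmetric] le] h(2) le
        by (intro exI[of _ "\<lambda>t. if t \<le> b then h t else k t"]) simp
    qed
  next
    fix x :: real assume "0 \<le> x" "x \<le> 1"
    then have "x \<in> {0..1}" by simp
    then obtain \<kappa> d L where *: "\<kappa> \<in> A" "0 < d" "0 \<le> L"
      "\<And>t. t \<in> {0..1} \<Longrightarrow> \<bar>t - x\<bar> < d \<Longrightarrow> t \<in> chart_times \<kappa>"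
      "\<And>t w. t \<in> {0..1} \<Longrightarrow> \<bar>t - x\<bar> < d \<Longrightarrow>
        norm (\<Gamma> \<kappa> (local_curve \<kappa> t) (local_velocity \<kappa> t) w) \<le> L * norm w"
      by (rule local_christoffel_bound) blast
    show "\<exists>d>0. \<forall>a b. a \<le> x \<and> x \<le> b \<and> b - a < d \<longrightarrow> P a b"
    \<comment> \<open>\<open>d\<close> keeps the interval inside the chart;
      \<open>1 / (L + 1)\<close> forces \<open>L * (b - a) < 1\<close> and is meaningful for
      \<open>L = 0\<close> as well.\<close>
    proof (intro exI[of _ "min d (1 / (L + 1))"] conjI allI impI)
      fix a b assume ab: "a \<le> x \<and> x \<le> b \<and> b - a < min d (1 / (L + 1))"
      have "L * (b - a) \<le> (L + 1) * (b - a)" using ab by (intro mult_right_mono) auto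
      also have "\<dots> < 1" using ab \<open>0 \<le> L\<close> by (simp add: field_simps)
      finally have "L * (b - a) < 1" .
      moreover have "\<bar>t - x\<bar> < d" if "t \<in> {a..b}" for t using that ab by auto
      ultimately show "P a b"
        unfolding P_def using * ab
        by (intro impI ballI local_parallel_on_exists[where \<kappa> = \<kappa> and L = L]) auto
    qed (use * in auto)
  qed simp
  then show ?thesis using \<eta> by (simp add: P_def)
qed

text \<open>Bisection again, now applied to the statement that a zero at the left end spreads over
  the interval. It chains because the zero at \<open>b\<close> is the initial value for the next
  piece.\<close>

lemma parallel_on_unique:
  assumes h: "parallel_on {0..1} h" "h 0 = 0"
  shows "t \<in> {0..1} \<Longrightarrow> h t = 0"
proof -
  define P where "P a b \<longleftrightarrow> ({a..b} \<subseteq> {0..1} \<longrightarrow> h a = 0 \<longrightarrow> (\<forall>t\<in>{a..b}. h t = 0))" for a b :: real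
  have "P 0 1"
  proof (rule Bolzano[of 0 1 P])
    fix a b e :: real assume P: "P a b" "P b e" and le: "a \<le> b" "b \<le> e"
    show "P a e"
      unfolding P_def
    proof (intro impI ballI)
      fix t assume sub: "{a..e} \<subseteq> {0..1}" and a: "h a = 0" and t: "t \<in> {a..e}"
      have sub': "{a..b} \<subseteq> {0..1}" "{b..e} \<subseteq> {0..1}" using sub le by auto
      then have "\<forall>t\<in>{a..b}. h t = 0" using P(1) a by (simp add: P_def)
      moreover from this have "\<forall>t\<in>{b..e}. h t = 0" using P(2) sub' le by (simp add: P_def)
      ultimately show "h t = 0" using t by (cases "t \<le> b") auto
    qed
  next
    fix x :: real assume "0 \<le> x" "x \<le> 1"
    then have "x \<in> {0..1}" by simp
    then obtain \<kappa> d L where *: "\<kappa> \<in> A" "0 < d" "0 \<le> L"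
      "\<And>t. t \<in> {0..1} \<Longrightarrow> \<bar>t - x\<bar> < d \<Longrightarrow> t \<in> chart_times \<kappa>"
      "\<And>t w. t \<in> {0..1} \<Longrightarrow> \<bar>t - x\<bar> < d \<Longrightarrow>
        norm (\<Gamma> \<kappa> (local_curve \<kappa> t) (local_velocity \<kappa> t) w) \<le> L * norm w"
      by (rule local_christoffel_bound) blast
    show "\<exists>d>0. \<forall>a b. a \<le> x \<and> x \<le> b \<and> b - a < d \<longrightarrow> P a b"
    proof (intro exI[of _ d] conjI allI impI)
      fix a b assume ab: "a \<le> x \<and> x \<le> b \<and> b - a < d"
      have near: "\<bar>t - x\<bar> < d" if "t \<in> {a..b}" for t using that ab by auto
      show "P a b"
        unfolding P_def
      proof (intro impI ballI)
        fix t assume sub: "{a..b} \<subseteq> {0..1}" and a: "h a = 0" and t: "t \<in> {a..b}"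
        have "{a..b} \<subseteq> chart_times \<kappa>" using *(4) near sub by blast
        then show "h t = 0"
          by (rule local_parallel_on_unique[OF _ *(1,5) parallel_on_subset[OF h(1) sub] a t])
            (use near sub in auto)
      qed
    qed (use * in auto)
  qed simp
  then show "t \<in> {0..1} \<Longrightarrow> h t = 0" using h(2) by (simp add: P_def)
qed

text \<open>Bootstrapping: the equation writes the derivative of \<open>h\<close> as a smooth
  expression in \<open>h\<close>, so each order of regularity yields the next one, starting from
  mere differentiability.\<close>

lemma Ck_on_parallel:
  assumes h: "parallel_on {0..1} h" and A: "\<kappa> \<in> A"
  shows "Ck_on k (chart_times \<kappa>) (\<lambda>t. h t \<kappa>)"
proof (induction k)
  have deriv: "((\<lambda>s. h s \<kappa>) has_vector_derivative
      - \<Gamma> \<kappa> (local_curve \<kappa> t) (local_velocity \<kappa> t) (h t \<kappa>)) (at t within chart_times \<kappa>)"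
    if "t \<in> chart_times \<kappa>" for t
    using h A that by (auto simp: vector_derivative_chart_times_iff parallel_on_def has_cov_deriv_0 chart_times_iff)
  case 0
  show ?case
    using has_derivative_continuous_on[OF deriv[unfolded has_vector_derivative_def]] by simp
  case (Suc k)
  show ?case
    unfolding Ck_on_Suc_iff_deriv[OF no_isolated_chart_times[OF A]]
    using deriv Ck_on_bounded_linear[OF no_isolated_chart_times[OF A] bounded_linear_minus[OF bounded_linear_ident] Ck_local_christoffel[OF A Suc.IH]]
    by (intro exI[of _ "\<lambda>t. - \<Gamma> \<kappa> (local_curve \<kappa> t) (local_velocity \<kappa> t) (h t \<kappa>)"]) simp
qed

lemma parallel_fields_iff:
  "h \<in> parallel_fields A \<Gamma> c \<longleftrightarrow> parallel_on {0..1} h \<and> (\<forall>t. t \<notin> {0..1} \<longrightarrow> h t = 0)"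
proof
  assume "h \<in> parallel_fields A \<Gamma> c"
  then have h: "h \<in> tangent_Imm A c" "\<And>t. t \<in> {0..1} \<Longrightarrow> cov_deriv A \<Gamma> c h t = 0"
    by (auto simp: parallel_fields_def)
  then show "parallel_on {0..1} h \<and> (\<forall>t. t \<notin> {0..1} \<longrightarrow> h t = 0)"
    using tangent_ImmD(1,2)[OF h(1)] has_cov_deriv_cov_deriv[OF h(1)] by (simp add: parallel_on_def)
next
  assume h: "parallel_on {0..1} h \<and> (\<forall>t. t \<notin> {0..1} \<longrightarrow> h t = 0)"
  then have "h \<in> tangent_Imm A c"
    using Ck_on_parallel unfolding tangent_Imm_def smooth_on_def chart_times_def parallel_on_def by blast
  moreover have "cov_deriv A \<Gamma> c h t = 0" if t: "t \<in> {0..1}" for t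
  proof
    fix \<kappa>
    show "cov_deriv A \<Gamma> c h t \<kappa> = 0 \<kappa>"
    proof (cases "\<kappa> \<in> charts_at A (c t)")
      case True
      then have "has_cov_deriv {0..1} \<kappa> h t 0" using h t by (auto simp: parallel_on_def)
      then show ?thesis by (rule cov_deriv_unique[OF t True])
    qed (simp add: cov_deriv_def)
  qed
  ultimately show "h \<in> parallel_fields A \<Gamma> c" by (simp add: parallel_fields_def)
qed

lemma parallel_transport_exists:
  assumes \<eta>: "\<eta> \<in> tangent_space A (c 0)"
  obtains h where "h \<in> parallel_fields A \<Gamma> c" "h 0 = \<eta>"
proof -
  obtain k where k: "parallel_on {0..1} k" "k 0 = \<eta>" using parallel_on_exists[OF \<eta>] by blast
  \<comment> \<open>Fields along \<open>c\<close> are normalised to vanish outside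
    \<open>[0,1]\<close>; the solution carries no information there and must be reset to 0.\<close>
  define h where "h t = (if t \<in> {0..1} then k t else 0)" for t
  have "has_cov_deriv {0..1} \<kappa> h t 0" if "t \<in> {0..1}" "\<kappa> \<in> charts_at A (c t)" for t \<kappa>
  proof -
    have kt: "((\<lambda>s. k s \<kappa>) has_vector_derivative
        - \<Gamma> \<kappa> (local_curve \<kappa> t) (local_velocity \<kappa> t) (k t \<kappa>)) (at t within {0..1})"
      using k(1) that by (auto simp: parallel_on_def has_cov_deriv_0)
    show ?thesis unfolding has_cov_deriv_0
      using has_vector_derivative_transform[OF that(1) _ kt, of "\<lambda>s. h s \<kappa>"] that(1) by (simp add: h_def)
  qed
  then have "h \<in> parallel_fields A \<Gamma> c"
    using k(1) unfolding parallel_fields_iff by (auto simp: parallel_on_def h_def)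
  moreover have "h 0 = \<eta>" by (simp add: h_def k(2))
  ultimately show ?thesis by (rule that)
qed

lemma parallel_field_eq_0:
  assumes "h \<in> parallel_fields A \<Gamma> c" "h 0 = 0"
  shows "h = 0"
  using assms parallel_on_unique[of h] unfolding parallel_fields_iff by (metis ext zero_fun_apply)

end

section \<open>The metric on immersed curves\<close>

lemma inner_product_on_commute: "inner_product_on V b \<Longrightarrow> x \<in> V \<Longrightarrow> y \<in> V \<Longrightarrow> b x y = b y x"
  and inner_product_on_add_left:
    "inner_product_on V b \<Longrightarrow> x \<in> V \<Longrightarrow> x' \<in> V \<Longrightarrow> y \<in> V \<Longrightarrow> b (x + x') y = b x y + b x' y"
  and inner_product_on_scaleR_left:
    "inner_product_on V b \<Longrightarrow> x \<in> V \<Longrightarrow> y \<in> V \<Longrightarrow> b (a *\<^sub>R x) y = a * b x y"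
  and inner_product_on_pos: "inner_product_on V b \<Longrightarrow> x \<in> V \<Longrightarrow> x \<noteq> 0 \<Longrightarrow> b x x > 0"
  unfolding inner_product_on_def by (elim conjE, simp)+

locale immersed_curve = curve X A \<Gamma> c
  for X :: "'a topology" and A :: "('a, 'e::euclidean_space) chart set" and \<Gamma> c +
  fixes g :: "('a, 'e) metric"
  assumes riemannian: "riemannian_manifold X A g"
    and immersed: "\<And>t. t \<in> {0..1} \<Longrightarrow> velocity A c t \<noteq> 0"
begin

section \<open>The inner product along the curve\<close>

lemma inner_product: "t \<in> {0..1} \<Longrightarrow> inner_product_on (tangent_space A (c t)) (g (c t))"
  using riemannian curve_topspace by (simp add: riemannian_manifold_def)

lemma g_commute:
  "t \<in> {0..1} \<Longrightarrow> \<xi> \<in> tangent_space A (c t) \<Longrightarrow> \<eta> \<in> tangent_space A (c t) \<Longrightarrow> g (c t) \<xi> \<eta> = g (c t) \<eta> \<xi>"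
  by (rule inner_product_on_commute[OF inner_product])

lemma g_add_left:
  "t \<in> {0..1} \<Longrightarrow> \<xi> \<in> tangent_space A (c t) \<Longrightarrow> \<xi>' \<in> tangent_space A (c t) \<Longrightarrow> \<eta> \<in> tangent_space A (c t) \<Longrightarrow>
    g (c t) (\<xi> + \<xi>') \<eta> = g (c t) \<xi> \<eta> + g (c t) \<xi>' \<eta>"
  by (rule inner_product_on_add_left[OF inner_product])

lemma g_scaleR_left:
  "t \<in> {0..1} \<Longrightarrow> \<xi> \<in> tangent_space A (c t) \<Longrightarrow> \<eta> \<in> tangent_space A (c t) \<Longrightarrow>
    g (c t) (a *\<^sub>R \<xi>) \<eta> = a * g (c t) \<xi> \<eta>"
  by (rule inner_product_on_scaleR_left[OF inner_product])

lemma g_pos: "t \<in> {0..1} \<Longrightarrow> \<xi> \<in> tangent_space A (c t) \<Longrightarrow> \<xi> \<noteq> 0 \<Longrightarrow> g (c t) \<xi> \<xi> > 0"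
  by (rule inner_product_on_pos[OF inner_product])

lemma g_zero_left: "t \<in> {0..1} \<Longrightarrow> \<eta> \<in> tangent_space A (c t) \<Longrightarrow> g (c t) 0 \<eta> = 0"
  using g_scaleR_left[of t 0 \<eta> 0] subspace_0[OF subspace_tangent_space] by simp

lemma g_zero_right: "t \<in> {0..1} \<Longrightarrow> \<eta> \<in> tangent_space A (c t) \<Longrightarrow> g (c t) \<eta> 0 = 0"
  using g_zero_left g_commute subspace_0[OF subspace_tangent_space] by metis

lemma g_nonneg: "t \<in> {0..1} \<Longrightarrow> \<xi> \<in> tangent_space A (c t) \<Longrightarrow> g (c t) \<xi> \<xi> \<ge> 0"
  using g_pos g_zero_left by (metis less_eq_real_def)

lemma g_local_metric:
  assumes "\<kappa> \<in> charts_at A p" "\<xi> \<in> tangent_space A p" "\<eta> \<in> tangent_space A p"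
  shows "g p \<xi> \<eta> = local_metric A g \<kappa> (chart_map \<kappa> p) (\<xi> \<kappa>) (\<eta> \<kappa>)"
  by (simp add: local_metric_def Let_def chart_inv_map coord_tvec_chart assms)

lemma bilinear_local_metric:
  assumes t: "t \<in> {0..1}" and \<kappa>: "\<kappa> \<in> charts_at A (c t)"
  shows "bilinear (local_metric A g \<kappa> (local_curve \<kappa> t))"
proof -
  let ?v = "coord_tvec A \<kappa> (c t)"
  note T = coord_tvec_tangent[OF \<kappa>]
  have eq: "local_metric A g \<kappa> (local_curve \<kappa> t) u v = g (c t) (?v u) (?v v)" for u v
    by (simp add: local_metric_def Let_def chart_inv_map[OF \<kappa>])
  have comm: "local_metric A g \<kappa> (local_curve \<kappa> t) u v = local_metric A g \<kappa> (local_curve \<kappa> t) v u" for u v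
    unfolding eq by (rule g_commute[OF t T T])
  have "linear (\<lambda>u. local_metric A g \<kappa> (local_curve \<kappa> t) u v)" for v
    unfolding eq
    by (rule linearI) (simp_all add: coord_tvec_add[OF \<kappa>] coord_tvec_scaleR[OF \<kappa>] g_add_left[OF t T T T] g_scaleR_left[OF t T T])
  moreover from this have "linear (\<lambda>v. local_metric A g \<kappa> (local_curve \<kappa> t) u v)" for u
    by (subst comm)
  ultimately show ?thesis by (simp add: bilinear_def)
qed

text \<open>The right regularity class for the integrand: closed under continuous scalar factors and
  differences, it contains the unit tangent and both parts of the arc-length derivative as soon as
  \<open>speed\<close> is continuous and positive.\<close>

definition continuous_field :: "(real \<Rightarrow> ('a, 'e) tvec) \<Rightarrow> bool"
  where "continuous_field \<xi> \<longleftrightarrow> (\<forall>t\<in>{0..1}. \<xi> t \<in> tangent_space A (c t)) \<and>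
    (\<forall>\<kappa>\<in>A. continuous_on (chart_times \<kappa>) (\<lambda>t. \<xi> t \<kappa>))"

lemma continuous_field_tangent: "continuous_field \<xi> \<Longrightarrow> t \<in> {0..1} \<Longrightarrow> \<xi> t \<in> tangent_space A (c t)"
  by (simp add: continuous_field_def)

text \<open>Continuity is local, so near each time a single chart suffices; there \<open>g\<close>
  becomes \<open>local_metric\<close>, bilinear in the two coordinate vectors and continuous in the
  base point.\<close>

lemma continuous_on_g:
  assumes \<xi>: "continuous_field \<xi>" and \<eta>: "continuous_field \<eta>"
  shows "continuous_on {0..1} (\<lambda>t. g (c t) (\<xi> t) (\<eta> t))"
  unfolding continuous_on_eq_continuous_within
proof
  fix t :: real assume t: "t \<in> {0..1}"
  obtain \<kappa> where "\<kappa> \<in> charts_at A (c t)" using charts_at_nonempty curve_topspace[OF t] by blast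
  then have A: "\<kappa> \<in> A" and t': "t \<in> chart_times \<kappa>" using t charts_atD chart_times_iff by blast+
  have x: "continuous_on (chart_times \<kappa>) (local_curve \<kappa>)"
    using smooth_local_curve[OF A] unfolding smooth_on_def by (metis Ck_on.simps(1))
  have "smooth_on (chart_range \<kappa>) (\<lambda>x. local_metric A g \<kappa> x u v)" for u v
    using riemannian A by (simp add: riemannian_manifold_def)
  then have G: "continuous_on (chart_range \<kappa>) (\<lambda>x. local_metric A g \<kappa> x u v)" for u v
    unfolding smooth_on_def by (metis Ck_on.simps(1))
  have "continuous_on (chart_times \<kappa>) (\<lambda>t. local_metric A g \<kappa> (local_curve \<kappa> t) (\<xi> t \<kappa>) (\<eta> t \<kappa>))"
  proof (rule continuous_on_bilinear_family[where f = "\<lambda>t. local_metric A g \<kappa> (local_curve \<kappa> t)"])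
    show "bilinear (local_metric A g \<kappa> (local_curve \<kappa> t))" if "t \<in> chart_times \<kappa>" for t
      using that A by (auto simp: chart_times_iff intro: bilinear_local_metric)
    show "continuous_on (chart_times \<kappa>) (\<lambda>t. local_metric A g \<kappa> (local_curve \<kappa> t) a b)" for a b
      by (rule continuous_on_compose2[OF G x]) (auto simp: chart_times_def)
  qed (use \<xi> \<eta> A in \<open>auto simp: continuous_field_def\<close>)
  then have "continuous_on (chart_times \<kappa>) (\<lambda>t. g (c t) (\<xi> t) (\<eta> t))"
    by (rule continuous_on_cong[THEN iffD1, rotated -1])
      (use A \<xi> \<eta> in \<open>auto simp: chart_times_iff continuous_field_tangent intro!: g_local_metric[symmetric]\<close>)
  then have "continuous (at t within chart_times \<kappa>) (\<lambda>t. g (c t) (\<xi> t) (\<eta> t))"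
    using t' by (simp add: continuous_on_eq_continuous_within)
  then show "continuous (at t within {0..1}) (\<lambda>t. g (c t) (\<xi> t) (\<eta> t))"
    by (simp add: at_within_chart_times[OF A t'])
qed

lemma continuous_field_scaleR:
  assumes f: "continuous_on {0..1} f" and \<xi>: "continuous_field \<xi>"
  shows "continuous_field (\<lambda>t. f t *\<^sub>R \<xi> t)"
  unfolding continuous_field_def
proof (intro conjI ballI)
  fix t :: real assume "t \<in> {0..1}"
  then show "f t *\<^sub>R \<xi> t \<in> tangent_space A (c t)"
    using \<xi> subspace_scale[OF subspace_tangent_space] by (simp add: continuous_field_def)
next
  fix \<kappa> assume \<kappa>: "\<kappa> \<in> A"
  have "continuous_on (chart_times \<kappa>) f" by (rule continuous_on_subset[OF f]) (auto simp: chart_times_def)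
  then show "continuous_on (chart_times \<kappa>) (\<lambda>t. (f t *\<^sub>R \<xi> t) \<kappa>)"
    using \<xi> \<kappa> by (auto simp: continuous_field_def scaleR_fun_def intro!: continuous_intros)
qed

lemma continuous_field_diff:
  assumes \<xi>: "continuous_field \<xi>" and \<eta>: "continuous_field \<eta>"
  shows "continuous_field (\<lambda>t. \<xi> t - \<eta> t)"
  using assms subspace_diff[OF subspace_tangent_space]
  by (auto simp: continuous_field_def intro!: continuous_intros)

lemma continuous_field_velocity: "continuous_field (velocity A c)"
  unfolding continuous_field_def
  using velocity_tangent smooth_local_velocity unfolding smooth_on_def by (metis Ck_on.simps(1))

lemma continuous_field_cov_deriv: "h \<in> tangent_Imm A c \<Longrightarrow> continuous_field (cov_deriv A \<Gamma> c h)"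
  unfolding continuous_field_def using cov_deriv_tangent Ck_on_cov_deriv by (metis Ck_on.simps(1))

text \<open>This is where immersion enters: it licenses division by the speed and, later, recovery
  of the covariant derivative from the arc-length derivative.\<close>

lemma speed_pos: "t \<in> {0..1} \<Longrightarrow> speed A g c t > 0"
  unfolding speed_def using g_pos velocity_tangent immersed by simp

lemma continuous_on_speed: "continuous_on {0..1} (speed A g c)"
  unfolding speed_def by (intro continuous_intros continuous_on_g continuous_field_velocity)

lemma continuous_on_inverse_speed: "continuous_on {0..1} (\<lambda>t. 1 / speed A g c t)"
  using speed_pos by (intro continuous_intros continuous_on_speed) fastforce

lemma continuous_field_unit_tangent: "continuous_field (unit_tangent A g c)"
  unfolding unit_tangent_def
  by (intro continuous_field_scaleR continuous_on_inverse_speed continuous_field_velocity)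

lemma continuous_field_arc_deriv: "h \<in> tangent_Imm A c \<Longrightarrow> continuous_field (arc_deriv A g \<Gamma> c h)"
  unfolding arc_deriv_def
  by (intro continuous_field_scaleR continuous_on_inverse_speed continuous_field_cov_deriv)

lemma continuous_field_arc_deriv_tan: "h \<in> tangent_Imm A c \<Longrightarrow> continuous_field (arc_deriv_tan A g \<Gamma> c h)"
  unfolding arc_deriv_tan_def
  by (intro continuous_field_scaleR continuous_on_g continuous_field_unit_tangent continuous_field_arc_deriv)

lemma continuous_field_arc_deriv_nor: "h \<in> tangent_Imm A c \<Longrightarrow> continuous_field (arc_deriv_nor A g \<Gamma> c h)"
  unfolding arc_deriv_nor_def
  by (intro continuous_field_diff continuous_field_arc_deriv continuous_field_arc_deriv_tan)

section \<open>The integrand of the metric and its definiteness\<close>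

definition G_density :: "(real \<Rightarrow> ('a, 'e) tvec) \<Rightarrow> (real \<Rightarrow> ('a, 'e) tvec) \<Rightarrow> real \<Rightarrow> real"
  where "G_density h k t =
    (g (c t) (arc_deriv_nor A g \<Gamma> c h t) (arc_deriv_nor A g \<Gamma> c k t) +
     1/4 * g (c t) (arc_deriv_tan A g \<Gamma> c h t) (arc_deriv_tan A g \<Gamma> c k t)) * speed A g c t"

lemma G_metric_density: "G_metric A g \<Gamma> c h k = g (c 0) (h 0) (k 0) + integral {0..1} (G_density h k)"
  by (simp add: G_metric_def G_density_def[abs_def])

lemma arc_deriv_eq_0:
  assumes "cov_deriv A \<Gamma> c h t = 0" "t \<in> {0..1}"
  shows "arc_deriv_tan A g \<Gamma> c h t = 0" "arc_deriv_nor A g \<Gamma> c h t = 0"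
  using assms g_zero_left[OF assms(2) continuous_field_tangent[OF continuous_field_unit_tangent]]
  by (simp_all add: arc_deriv_nor_def arc_deriv_tan_def arc_deriv_def)

lemma G_density_parallel:
  assumes "h \<in> parallel_fields A \<Gamma> c" "k \<in> tangent_Imm A c" "t \<in> {0..1}"
  shows "G_density h k t = 0" "G_density k h t = 0"
  using assms arc_deriv_eq_0[of h t]
    continuous_field_tangent[OF continuous_field_arc_deriv_tan[OF assms(2)] assms(3)]
    continuous_field_tangent[OF continuous_field_arc_deriv_nor[OF assms(2)] assms(3)]
  by (simp_all add: parallel_fields_def G_density_def g_zero_left g_zero_right)

text \<open>The integrand vanishes identically once one argument is parallel. Both argument orders
  are recorded: \<open>horizontal\<close> puts the vertical field second,
  \<open>orthogonal_direct_sum\<close> puts it first.\<close>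

lemma G_metric_parallel:
  assumes "h \<in> parallel_fields A \<Gamma> c" "k \<in> tangent_Imm A c"
  shows "G_metric A g \<Gamma> c h k = g (c 0) (h 0) (k 0)" "G_metric A g \<Gamma> c k h = g (c 0) (k 0) (h 0)"
proof -
  have "integral {0..1} (G_density h k) = 0"
    by (intro integral_unique has_integral_is_0 G_density_parallel[OF assms])
  then show "G_metric A g \<Gamma> c h k = g (c 0) (h 0) (k 0)" by (simp add: G_metric_density)
  have "integral {0..1} (G_density k h) = 0"
    by (intro integral_unique has_integral_is_0 G_density_parallel[OF assms])
  then show "G_metric A g \<Gamma> c k h = g (c 0) (k 0) (h 0)" by (simp add: G_metric_density)
qed

lemma continuous_on_G_density: "h \<in> tangent_Imm A c \<Longrightarrow> continuous_on {0..1} (G_density h h)"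
  unfolding G_density_def
  by (intro continuous_intros continuous_on_g continuous_field_arc_deriv_nor continuous_field_arc_deriv_tan
      continuous_on_speed)

text \<open>The weights 1 and \<open>1/4\<close> and the speed are positive, so a vanishing
  integrand forces the normal and the tangential part to vanish separately; their sum is the
  arc-length derivative.\<close>

lemma cov_deriv_eq_0:
  assumes h: "h \<in> tangent_Imm A c" and int: "integral {0..1} (G_density h h) = 0" and t: "t \<in> {0..1}"
  shows "cov_deriv A \<Gamma> c h t = 0"
proof -
  let ?N = "arc_deriv_nor A g \<Gamma> c h" and ?T = "arc_deriv_tan A g \<Gamma> c h"
  have T: "?T s \<in> tangent_space A (c s)" and N: "?N s \<in> tangent_space A (c s)" if "s \<in> {0..1}" for s
    using that h continuous_field_tangent continuous_field_arc_deriv_nor continuous_field_arc_deriv_tan by blast+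
  have "G_density h h s \<ge> 0" if "s \<in> {0..1}" for s
    using that g_nonneg[OF that T] g_nonneg[OF that N] speed_pos[OF that] by (simp add: G_density_def)
  then have "G_density h h t = 0"
    using integral_eq_0_iff[OF continuous_on_G_density[OF h]] int t by simp
  then have "g (c t) (?N t) (?N t) + 1/4 * g (c t) (?T t) (?T t) = 0"
    using speed_pos[OF t] by (simp add: G_density_def)
  then have "g (c t) (?N t) (?N t) = 0" "g (c t) (?T t) (?T t) = 0"
    using g_nonneg[OF t T[OF t]] g_nonneg[OF t N[OF t]] by linarith+
  then have "?N t = 0" "?T t = 0" using g_pos[OF t T[OF t]] g_pos[OF t N[OF t]] by fastforce+
  then have "arc_deriv A g \<Gamma> c h t = 0" by (simp add: arc_deriv_nor_def)
  then show ?thesis using speed_pos[OF t] by (simp add: arc_deriv_def)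
qed

section \<open>Vertical and horizontal fields\<close>

lemma verticalD: "k \<in> vertical A c \<Longrightarrow> k \<in> tangent_Imm A c" "k \<in> vertical A c \<Longrightarrow> k 0 = 0"
  by (simp_all add: vertical_def base_proj_deriv_def)

lemma parallel_tangent_Imm: "h \<in> parallel_fields A \<Gamma> c \<Longrightarrow> h \<in> tangent_Imm A c"
  by (simp add: parallel_fields_def)

text \<open>Serves twice: it supplies the test field \<open>h - p\<close> that pins down the
  horizontal space, and it shows that the two spaces span.\<close>

lemma vertical_decomposition:
  assumes h: "h \<in> tangent_Imm A c"
  obtains p where "p \<in> parallel_fields A \<Gamma> c" "p 0 = h 0" "h - p \<in> vertical A c"
proof -
  obtain p where p: "p \<in> parallel_fields A \<Gamma> c" "p 0 = h 0"
    using parallel_transport_exists[OF tangent_ImmD(1)[OF h, of 0]] by auto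
  then have "h - p \<in> vertical A c"
    using subspace_diff[OF subspace_tangent_Imm h parallel_tangent_Imm]
    by (simp add: vertical_def base_proj_deriv_def)
  with p show ?thesis by (rule that)
qed

lemma horizontal_eq_parallel: "horizontal A g \<Gamma> c = parallel_fields A \<Gamma> c"
proof (intro set_eqI iffI)
  fix h assume "h \<in> horizontal A g \<Gamma> c"
  then have h: "h \<in> tangent_Imm A c" and orth: "\<And>k. k \<in> vertical A c \<Longrightarrow> G_metric A g \<Gamma> c h k = 0"
    by (auto simp: horizontal_def)
  obtain p where p: "p \<in> parallel_fields A \<Gamma> c" "p 0 = h 0" and k: "h - p \<in> vertical A c"
    using vertical_decomposition[OF h] by blast
  note k' = verticalD[OF k]
  have cov: "cov_deriv A \<Gamma> c h t = cov_deriv A \<Gamma> c (h - p) t" if "t \<in> {0..1}" for t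
    using cov_deriv_add[OF k'(1) parallel_tangent_Imm[OF p(1)] that] p(1) that by (simp add: parallel_fields_def)
  \<comment> \<open>The integrand depends on its first argument only through the covariant
    derivative, so \<open>h\<close> may be replaced by \<open>h - p\<close> there. This turns the
    orthogonality relation into a quadratic form without expanding \<open>G_metric\<close>.\<close>
  have dens: "G_density h (h - p) t = G_density (h - p) (h - p) t" if "t \<in> {0..1}" for t
    by (simp add: G_density_def arc_deriv_nor_def arc_deriv_tan_def arc_deriv_def cov[OF that])
  have "g (c 0) (h 0) ((h - p) 0) = 0"
    unfolding k'(2) using g_zero_right[of 0] tangent_ImmD(1)[OF h, of 0] by simp
  then have "integral {0..1} (G_density h (h - p)) = 0"
    using orth[OF k] by (simp only: G_metric_density)
  then have "integral {0..1} (G_density (h - p) (h - p)) = 0"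
    using Henstock_Kurzweil_Integration.integral_cong[of "{0..1}" "G_density h (h - p)", OF dens] by simp
  then have "cov_deriv A \<Gamma> c h t = 0" if "t \<in> {0..1}" for t
    using cov_deriv_eq_0[OF k'(1)] cov that by simp
  then show "h \<in> parallel_fields A \<Gamma> c" using h by (simp add: parallel_fields_def)
next
  fix h assume h: "h \<in> parallel_fields A \<Gamma> c"
  have "G_metric A g \<Gamma> c h k = 0" if "k \<in> vertical A c" for k
    using G_metric_parallel(1)[OF h verticalD(1)[OF that]] verticalD(2)[OF that]
      g_zero_right[of 0] tangent_ImmD(1)[OF parallel_tangent_Imm[OF h], of 0] by simp
  then show "h \<in> horizontal A g \<Gamma> c" using parallel_tangent_Imm[OF h] by (simp add: horizontal_def)
qed

lemma subspace_vertical: "subspace (vertical A c)"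
  using subspace_tangent_Imm by (auto simp: vertical_def base_proj_deriv_def subspace_def scaleR_fun_def)

lemma tangent_Imm_direct_sum:
  "orthogonal_direct_sum (G_metric A g \<Gamma> c) (tangent_Imm A c) (vertical A c) (horizontal A g \<Gamma> c)"
  unfolding orthogonal_direct_sum_def horizontal_eq_parallel
proof (intro conjI ballI subspace_tangent_Imm subspace_vertical subspace_parallel_fields)
  show "vertical A c \<inter> parallel_fields A \<Gamma> c = {0}"
    using parallel_field_eq_0 verticalD(2) subspace_0[OF subspace_vertical] subspace_0[OF subspace_parallel_fields]
    by blast
  show "{v + w |v w. v \<in> vertical A c \<and> w \<in> parallel_fields A \<Gamma> c} = tangent_Imm A c"
  proof (intro set_eqI iffI)
    fix h assume "h \<in> {v + w |v w. v \<in> vertical A c \<and> w \<in> parallel_fields A \<Gamma> c}"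
    then show "h \<in> tangent_Imm A c"
      using verticalD(1) parallel_tangent_Imm subspace_add[OF subspace_tangent_Imm] by blast
  next
    fix h assume "h \<in> tangent_Imm A c"
    then obtain p where "p \<in> parallel_fields A \<Gamma> c" "h - p \<in> vertical A c"
      using vertical_decomposition by blast
    moreover have "h = (h - p) + p" by simp
    ultimately show "h \<in> {v + w |v w. v \<in> vertical A c \<and> w \<in> parallel_fields A \<Gamma> c}" by blast
  qed
  fix v w assume v: "v \<in> vertical A c" and w: "w \<in> parallel_fields A \<Gamma> c"
  show "G_metric A g \<Gamma> c v w = 0"
    using G_metric_parallel(2)[OF w verticalD(1)[OF v]] verticalD(2)[OF v]
      g_zero_left[of 0] tangent_ImmD(1)[OF parallel_tangent_Imm[OF w], of 0] by simp
qed

text \<open>On parallel fields the integral vanishes and \<open>G_metric\<close> reduces to the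
  inner product at \<open>c 0\<close>. Surjectivity is existence of parallel transport, injectivity
  its uniqueness.\<close>

lemma base_proj_isometry:
  "linear_isometry_onto base_proj_deriv (horizontal A g \<Gamma> c) (G_metric A g \<Gamma> c)
    (tangent_space A (base_proj c)) (g (base_proj c))"
  unfolding linear_isometry_onto_def horizontal_eq_parallel base_proj_def base_proj_deriv_def
proof (intro conjI ballI allI)
  fix x y assume x: "x \<in> parallel_fields A \<Gamma> c" and y: "y \<in> parallel_fields A \<Gamma> c"
  show "g (c 0) (x 0) (y 0) = G_metric A g \<Gamma> c x y"
    by (rule G_metric_parallel(1)[OF x parallel_tangent_Imm[OF y], symmetric])
next
  show "bij_betw (\<lambda>h. h 0) (parallel_fields A \<Gamma> c) (tangent_space A (c 0))"
    unfolding bij_betw_def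
  proof
    show "inj_on (\<lambda>h. h 0) (parallel_fields A \<Gamma> c)"
    proof (rule inj_onI)
      fix h k assume "h \<in> parallel_fields A \<Gamma> c" "k \<in> parallel_fields A \<Gamma> c" "h 0 = k 0"
      then have "h - k = 0"
        by (intro parallel_field_eq_0 subspace_diff[OF subspace_parallel_fields]) simp_all
      then show "h = k" by simp
    qed
    show "(\<lambda>h. h 0) ` parallel_fields A \<Gamma> c = tangent_space A (c 0)"
      using tangent_ImmD(1)[OF parallel_tangent_Imm, of _ 0] by (auto elim: parallel_transport_exists)
  qed
qed (simp_all add: scaleR_fun_def)

end

theorem proposition2:
  fixes X :: "'a topology"
    and A :: "('a, 'e::euclidean_space) chart set"
    and g :: "('a, 'e) metric"
    and \<Gamma> :: "('a, 'e) christoffel"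
  assumes "riemannian_manifold X A g"
    and "levi_civita A g \<Gamma>"
  shows "(\<forall>c\<in>Imm X A. orthogonal_direct_sum (G_metric A g \<Gamma> c)
            (tangent_Imm A c) (vertical A c) (horizontal A g \<Gamma> c)) \<and>
    (\<forall>c\<in>Imm X A. horizontal A g \<Gamma> c = parallel_fields A \<Gamma> c) \<and>
    (\<forall>c\<in>Imm X A. linear_isometry_onto base_proj_deriv
            (horizontal A g \<Gamma> c) (G_metric A g \<Gamma> c)
            (tangent_space A (base_proj c)) (g (base_proj c)))"
proof -
  have curve: "immersed_curve X A \<Gamma> c g" if "c \<in> Imm X A" for c
    using assms that by unfold_locales (auto simp: riemannian_manifold_def levi_civita_def Imm_def)
  show ?thesis
    using immersed_curve.tangent_Imm_direct_sum[OF curve] immersed_curve.horizontal_eq_parallel[OF curve]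
      immersed_curve.base_proj_isometry[OF curve] by blast
qed

end
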